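(* For every integer $N\geq 2$, $$\varepsilon_0(N,2)=2\sum_{i=0}^{N-2}\varepsilon_0(i)\,\varepsilon_0(N-i-1,2)+N(2N-1)\,\varepsilon_0(N-1).$$
   Context: Gluings and their counts. Let $N\ge 1$, $K\ge1$. A gluing datum with $N$ edges and $K$ faces consists of a composition $(m_1,\dots,m_K)$ of $2N$ into positive integers together with a fixed-point-free involution $\iota$ of $\{1,\dots,2N\}$. Put $s_0=0$, $s_i=m_1+\dots+m_i$, and let $\tau$ be the permutation of $\{1,\dots,2N\}$ whose cycles are $(s_{i-1}+1,\,s_{i-1}+2,\,\dots,\,s_i)$, $i=1,\dots,K$. The datum is connected if the group $\langle\iota,\tau\rangle$ acts transitively on $\{1,\dots,2N\}$, and it has genus $g$ if the permutation $\tau\iota$ has exactly $N-K+2-2g$ cycles. (Geometrically: this is the gluing of $K$ numbered polygons with $m_1,\dots,m_K$ edges, each with a distinguished edge, where the edges are paired by $\iota$ and paired edges are glued with opposite orientations, producing a connected closed orientable surface of genus $g$; equivalently a rooted map on that surface with $N$ edges and $K$ numbered faces, each face having one marked arc, counted up to isomorphism.) $\varepsilon_g(N,K)$ denotes the number of connected gluing data of genus $g$ with $N$ edges and $K$ faces. For $N=0$ one sets $\varepsilon_0(0,1)=1$ and $\varepsilon_g(0,K)=0$ if $g+K>1$. Also $\varepsilon_g(N):=\varepsilon_g(N,1)$ (gluings from a single polygon). *)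

theory Defs
  imports "HOL-Algebra.Sym_Groups" "HOL-Combinatorics.Orbits"
begin

text \<open>Permutations of \<open>{1..2 * N}\<close> are functions on \<open>nat\<close> that are the identity outside this set, so
  that each permutation is represented by exactly one function.\<close>

definition face_offset :: "nat list \<Rightarrow> nat \<Rightarrow> nat" where
  "face_offset ms i = sum_list (take i ms)"

text \<open>Faces are indexed from \<open>0\<close>: the \<open>i\<close>-th factor is the cycle
  \<open>(s\<^sub>i + 1, \<dots>, s\<^bsub>i+1\<^esub>)\<close> with \<open>s\<^sub>i = face_offset ms i\<close>; it maps each
  entry to the next one, and it is the identity if there is only one entry.\<close>

definition face_perm :: "nat list \<Rightarrow> nat \<Rightarrow> nat" where
  "face_perm ms =
     foldr (\<circ>) (map (\<lambda>i. cycle_of_list [face_offset ms i + 1..<face_offset ms (Suc i) + 1])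
                 [0..<length ms]) id"

definition gluing_datum :: "nat \<Rightarrow> nat \<Rightarrow> nat list \<times> (nat \<Rightarrow> nat) \<Rightarrow> bool" where
  "gluing_datum N K = (\<lambda>(ms, \<iota>).
     length ms = K \<and> (\<forall>m\<in>set ms. 0 < m) \<and> sum_list ms = 2 * N \<and>
     \<iota> permutes {1..2 * N} \<and> (\<forall>x\<in>{1..2 * N}. \<iota> x \<noteq> x \<and> \<iota> (\<iota> x) = x))"

definition connected_gluing :: "nat \<Rightarrow> nat list \<times> (nat \<Rightarrow> nat) \<Rightarrow> bool" where
  "connected_gluing N = (\<lambda>(ms, \<iota>).
     \<forall>x\<in>{1..2 * N}. \<forall>y\<in>{1..2 * N}.
       \<exists>p\<in>generate (sym_group (2 * N)) {\<iota>, face_perm ms}. p x = y)"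

text \<open>Fixed points count as cycles.\<close>

definition num_cycles :: "nat \<Rightarrow> (nat \<Rightarrow> nat) \<Rightarrow> nat" where
  "num_cycles n p = card (orbit p ` {1..n})"

definition has_genus :: "nat \<Rightarrow> nat \<Rightarrow> nat \<Rightarrow> nat list \<times> (nat \<Rightarrow> nat) \<Rightarrow> bool" where
  "has_genus g N K = (\<lambda>(ms, \<iota>).
     int (num_cycles (2 * N) (face_perm ms \<circ> \<iota>)) = int N - int K + 2 - 2 * int g)"

definition gluings :: "nat \<Rightarrow> nat \<Rightarrow> nat \<Rightarrow> (nat list \<times> (nat \<Rightarrow> nat)) set" where
  "gluings g N K = {d. gluing_datum N K d \<and> connected_gluing N d \<and> has_genus g N K d}"

text \<open>The value for \<open>N = 0\<close> is a convention. It includes the degenerate arguments with \<open>K = 0\<close>, which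
  have no meaning of their own.\<close>

definition gluing_count :: "nat \<Rightarrow> nat \<Rightarrow> nat \<Rightarrow> nat"  (\<open>\<epsilon>\<close>) where
  "\<epsilon> g N K =
     (if N = 0 then (if g = 0 \<and> K = 1 then 1 else 0) else card (gluings g N K))"

abbreviation polygon_gluing_count :: "nat \<Rightarrow> nat \<Rightarrow> nat"  (\<open>\<epsilon>\<^sub>P\<close>) where
  "\<epsilon>\<^sub>P g N \<equiv> \<epsilon> g N 1"

lemma finite_gluings: "finite (gluings g N K)"
proof (rule finite_subset)
  show "gluings g N K \<subseteq>
      {ms. set ms \<subseteq> {..2 * N} \<and> length ms = K} \<times> {\<iota>. \<iota> permutes {1..2 * N}}"
    using member_le_sum_list by (fastforce simp: gluings_def gluing_datum_def)
  show "finite ({ms. set ms \<subseteq> {..2 * N} \<and> length ms = K} \<times> {\<iota>. \<iota> permutes {1..2 * N}})"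
    by (intro finite_cartesian_product finite_lists_length_eq finite_permutations) auto
qed

end

theory Submission
  imports Defs
begin

text \<open>Let the marked edge of the first polygon be glued to an edge \<open>e\<close>, and remove this pair of edges.
  If \<open>e\<close> belongs to the second polygon, the two faces merge into a single polygon with \<open>2 * N - 2\<close>
  edges; there are as many positions of \<open>e\<close> as the second polygon has edges, and summing this
  over all compositions of \<open>2 * N\<close> gives \<open>N * (2 * N - 1)\<close>. If \<open>e\<close> belongs to the first polygon, that polygon
  splits into two. By Euler's inequality a planar gluing cannot keep both parts connected to the
  second polygon, so one part is glued to itself and the other one is glued to the second polygon.

  Counting matchings on arbitrary lists of edge labels avoids relabelling after the removal, since the
  counts depend only on the lengths of the lists.\<close>

subsection \<open>Cycle counts\<close>

text \<open>The claim concerns sums over all pairs of face lengths, but the removal of an edge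
  changes the two lengths separately. The recursion is therefore proved for fixed lengths, odd ones
  included, and only then summed over all lengths with a given total. Reflecting the position of the
  partner inside the first polygon exchanges the two parts, which gives the factor 2; parts of odd
  length that are glued to themselves contribute nothing. Genus 0 is read off the number of
  vertices, that is, of cycles of \<open>f \<circ> p\<close>: with \<open>E\<close> edges and
  \<open>F\<close> faces there must be \<open>E - F + 2\<close> of them. All such equations are
  doubled, so that \<open>2 * E\<close> is the total length of the faces and no division occurs.
  Both kinds of removal rest on one identity: multiplication by the transposition of
  \<open>a\<close> and \<open>b\<close> splits a cycle that contains both points and joins two
  cycles that contain one each.\<close>

definition ncyc :: "'a set \<Rightarrow> ('a \<Rightarrow> 'a) \<Rightarrow> nat" where
  "ncyc A p = card (orbit p ` A)"

lemma orbit_subset_invariant: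
  assumes "x \<in> S" "p ` S \<subseteq> S"
  shows "orbit p x \<subseteq> S"
proof
  fix y assume "y \<in> orbit p x"
  then show "y \<in> S" using assms by induction auto
qed

lemma orbit_invariant: "p ` orbit p x \<subseteq> orbit p x"
  by (auto intro: orbit.step)

text \<open>\<open>orbit p x\<close> is generated from \<open>p x\<close>; it contains
  \<open>x\<close> because a permutation of a finite set returns to its starting point.\<close>

lemma permutes_self_in_orbit:
  assumes "finite A" "p permutes A"
  shows "x \<in> orbit p x"
  using assms by (meson permutation_permutes permutation_self_in_orbit)

lemma permutes_orbit_eq:
  assumes "finite A" "p permutes A" "y \<in> orbit p x"
  shows "orbit p y = orbit p x"
  using assms by (meson cyclic_on_orbit orbit_cyclic_eq3)

lemma ncyc_Un:
  assumes "finite A" "finite B" "A \<inter> B = {}" "p ` A \<subseteq> A" "p ` B \<subseteq> B"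
  shows "ncyc (A \<union> B) p = ncyc A p + ncyc B p"
proof -
  have "orbit p x \<noteq> orbit p y" if "x \<in> A" "y \<in> B" for x y
    using orbit_subset_invariant[OF that(1) assms(4)] orbit_subset_invariant[OF that(2) assms(5)]
      orbit.base[of p x] assms(3) by auto
  then have "orbit p ` A \<inter> orbit p ` B = {}" by blast
  then show ?thesis
    using assms(1,2) by (simp add: ncyc_def image_Un card_Un_disjoint)
qed

lemma ncyc_cong:
  assumes "p ` A \<subseteq> A" "\<And>x. x \<in> A \<Longrightarrow> q x = p x"
  shows "ncyc A q = ncyc A p"
proof -
  have "orbit p x = orbit q x" if "x \<in> A" for x
    using that assms by (intro orbit_cong0[where A = A]) auto
  then show ?thesis by (simp add: ncyc_def)
qed

lemma ncyc_insert_fixed: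
  assumes "finite A" "p permutes A" "a \<notin> A"
  shows "ncyc (insert a A) p = Suc (ncyc A p)"
proof -
  have "p a = a" using assms by (simp add: permutes_not_in)
  moreover have "p ` A = A" using assms by (simp add: permutes_image)
  ultimately show ?thesis
    using ncyc_Un[of "{a}" A p] assms by (simp add: ncyc_def)
qed

lemma ncyc_conj:
  assumes "bij h"
  shows "ncyc (h ` A) (h \<circ> p \<circ> inv' h) = ncyc A p"
proof -
  have inv: "inv' h (h x) = x" for x using assms by (simp add: bij_is_inj)
  have "orbit (h \<circ> p \<circ> inv' h) (h x) = h ` orbit p x" for x
  proof -
    have "((h \<circ> p \<circ> inv' h) ^^ n) (h x) = h ((p ^^ n) x)" for n
      by (induction n) (auto simp: inv)
    then show ?thesis by (auto simp: orbit_altdef)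
  qed
  then have "orbit (h \<circ> p \<circ> inv' h) ` h ` A = (`) h ` orbit p ` A"
    by (auto simp: image_image)
  moreover have "inj_on ((`) h) (orbit p ` A)"
    using assms by (meson bij_is_inj inj_image_eq_iff inj_onI)
  ultimately show ?thesis by (simp add: ncyc_def card_image)
qed

text \<open>The two products are conjugate by \<open>p\<close>. This reconciles
  \<open>face_perm ms \<circ> \<iota>\<close> in the definition of the genus with the order
  \<open>f \<circ> p\<close> used in the counting.\<close>

lemma ncyc_comp_commute:
  assumes "p permutes A"
  shows "ncyc A (q \<circ> p) = ncyc A (p \<circ> q)"
proof -
  have "p \<circ> (q \<circ> p) \<circ> inv' p = p \<circ> q"
    using assms by (simp add: fun_eq_iff permutes_inverses)
  moreover have "p ` A = A" using assms by (simp add: permutes_image)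
  ultimately show ?thesis
    using ncyc_conj[of p A "q \<circ> p"] permutes_bij[OF assms] by simp
qed

section \<open>Effect of a transposition on the cycles of a permutation\<close>

context
  fixes A :: "'a set" and p q :: "'a \<Rightarrow> 'a" and a b :: 'a
  assumes fin: "finite A" and perm: "p permutes A" and ab: "a \<in> A" "b \<in> A"
  defines "q \<equiv> transpose a b \<circ> p"
begin

lemma transpose_comp_permutes: "q permutes A"
  unfolding q_def using perm ab by (intro permutes_compose permutes_swap_id)

text \<open>Only the cycles through \<open>a\<close> and \<open>b\<close> change. \<open>S\<close>
  is their union, and the cycles outside \<open>S\<close> are common to \<open>p\<close> and
  \<open>q\<close>; the third equation cancels them without subtracting natural numbers.\<close>

lemma ncyc_transpose_split:
  obtains S where "ncyc S p = card {orbit p a, orbit p b}" "ncyc S q = card {orbit q a, orbit q b}"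
    "ncyc A p + ncyc S q = ncyc A q + ncyc S p"
proof -
  define S where "S = orbit p a \<union> orbit p b"
  have SA: "S \<subseteq> A"
    unfolding S_def using perm ab permutes_orbit_subset by fastforce
  have in_p: "x \<in> orbit p x" and in_q: "x \<in> orbit q x" for x
    using permutes_self_in_orbit fin perm transpose_comp_permutes by metis+
  have pS: "p ` S \<subseteq> S" unfolding S_def using orbit_invariant by fastforce
  then have pS_eq: "p ` S = S"
    using endo_inj_surj[of S p] finite_subset[OF SA fin] permutes_inj_on[OF perm] by simp
  have pR: "p ` (A - S) = A - S"
    using pS_eq SA perm by (metis image_set_diff permutes_image permutes_inj)
  have abS: "a \<in> S" "b \<in> S" using in_p by (auto simp: S_def)
  have qp: "q x = p x" if "x \<in> A - S" for x
    using pR that abS unfolding q_def by (auto simp: transpose_def)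
  have qS: "q ` S \<subseteq> S"
    using pS abS unfolding q_def by (auto simp: transpose_def)
  \<comment> \<open>\<open>T\<close> is the same union formed with \<open>q\<close>. The inclusion
    of \<open>S\<close> in \<open>T\<close> shows that \<open>q\<close> has no cycles on
    \<open>S\<close> besides those of \<open>a\<close> and \<open>b\<close>.\<close>
  define T where "T = orbit q a \<union> orbit q b"
  have "p ` T \<subseteq> T"
  proof
    fix y assume "y \<in> p ` T"
    then obtain x where x: "x \<in> T" "y = p x" by auto
    then have "q x \<in> T" unfolding T_def using orbit_invariant by fastforce
    moreover have "y = q x \<or> y = a \<or> y = b"
      unfolding q_def x(2) by (auto simp: transpose_def)
    ultimately show "y \<in> T" unfolding T_def using in_q by auto
  qed
  then have ST: "S \<subseteq> T"
    unfolding S_def using orbit_subset_invariant[of _ T p] in_q by (simp add: T_def)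
  have "orbit p x = orbit p a \<or> orbit p x = orbit p b" if "x \<in> S" for x
    using that permutes_orbit_eq[OF fin perm] unfolding S_def by blast
  with abS have "orbit p ` S = {orbit p a, orbit p b}" by blast
  moreover have "orbit q x = orbit q a \<or> orbit q x = orbit q b" if "x \<in> S" for x
    using that ST permutes_orbit_eq[OF fin transpose_comp_permutes] unfolding T_def by blast
  with abS have "orbit q ` S = {orbit q a, orbit q b}" by blast
  moreover have "ncyc A p = ncyc S p + ncyc (A - S) p"
    using ncyc_Un[of S "A - S" p] SA fin pS pR by (simp add: finite_subset Un_absorb1)
  moreover have "ncyc A q = ncyc S q + ncyc (A - S) p"
  proof -
    have "q ` (A - S) \<subseteq> A - S" using qp pR by force
    then show ?thesis
      using ncyc_Un[of S "A - S" q] ncyc_cong[of p "A - S" q] SA fin qS pR qp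
      by (simp add: finite_subset Un_absorb1)
  qed
  ultimately show ?thesis by (intro that[of S]) (simp_all add: ncyc_def)
qed

lemma ncyc_transpose_le: "ncyc A q \<le> Suc (ncyc A p)"
proof (rule ncyc_transpose_split)
  fix S assume S: "ncyc S p = card {orbit p a, orbit p b}" "ncyc S q = card {orbit q a, orbit q b}"
    "ncyc A p + ncyc S q = ncyc A q + ncyc S p"
  have "ncyc S p \<ge> 1" "ncyc S q \<le> 2" unfolding S by (auto simp: card_insert_if)
  then show ?thesis using S(3) by linarith
qed

text \<open>\<open>p\<close> and \<open>q\<close> differ only where \<open>p\<close> takes the value
  \<open>a\<close> or \<open>b\<close>. If both orbits of \<open>a\<close> avoided \<open>b\<close>,
  the two maps would agree along them and never return to \<open>a\<close>, although the
  \<open>p\<close>-cycle of \<open>a\<close> must.\<close>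

lemma transpose_join_in_orbit:
  assumes "b \<notin> orbit p a"
  shows "b \<in> orbit q a"
proof (rule ccontr)
  assume nb: "b \<notin> orbit q a"
  have in_p: "x \<in> orbit p x" and in_q: "x \<in> orbit q x" for x
    using permutes_self_in_orbit fin perm transpose_comp_permutes by metis+
  define U where "U = orbit q a \<inter> orbit p a"
  have step: "p y \<in> U \<and> p y \<noteq> a" if "y \<in> U" for y
  proof -
    have "q y \<in> orbit q a" "p y \<in> orbit p a"
      using that by (auto simp: U_def intro: orbit.step)
    moreover from this nb assms have "q y \<noteq> b" "p y \<noteq> b" by auto
    moreover from this have "p y \<noteq> a" "q y = p y" by (auto simp: q_def transpose_def)
    ultimately show ?thesis by (simp add: U_def)
  qed
  moreover have aU: "a \<in> U" using in_p in_q by (simp add: U_def)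
  ultimately have "orbit p a \<subseteq> U" by (intro orbit_subset_invariant) auto
  moreover obtain y where "y \<in> orbit p a" "p y = a"
    using in_p[of a] by (metis in_p orbit.cases)
  ultimately show False using step by blast
qed

lemma ncyc_transpose_join:
  assumes "b \<notin> orbit p a"
  shows "ncyc A p = Suc (ncyc A q)"
proof (rule ncyc_transpose_split)
  fix S assume S: "ncyc S p = card {orbit p a, orbit p b}" "ncyc S q = card {orbit q a, orbit q b}"
    "ncyc A p + ncyc S q = ncyc A q + ncyc S p"
  have "orbit q a = orbit q b"
    using permutes_orbit_eq[OF fin transpose_comp_permutes transpose_join_in_orbit[OF assms]] by simp
  moreover have "orbit p a \<noteq> orbit p b"
    using assms permutes_self_in_orbit[OF fin perm] by auto
  ultimately show ?thesis using S by simp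
qed

end

text \<open>As a fixed point of \<open>p\<close>, the new point \<open>a\<close> adds one cycle; the
  transposition then joins it to the cycle of \<open>j\<close>, directly before
  \<open>j\<close>.\<close>

lemma ncyc_insert_transpose:
  assumes "finite A" "p permutes A" "a \<notin> A" "j \<in> A"
  shows "ncyc (insert a A) (transpose a j \<circ> p) = ncyc A p"
proof -
  have p: "p permutes insert a A" using assms(2) by (rule permutes_subset) auto
  have "orbit p a = {a}" using assms by (simp add: orbit_eq_singleton_iff permutes_not_in)
  then have "j \<notin> orbit p a" using assms by auto
  then have "ncyc (insert a A) p = Suc (ncyc (insert a A) (transpose a j \<circ> p))"
    using assms by (intro ncyc_transpose_join p) auto
  then show ?thesis using ncyc_insert_fixed[OF assms(1-3)] by linarith
qed

subsection \<open>Transitive pairs and the genus bound\<close>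

lemma ncyc_eq_1_orbit:
  assumes "finite A" "p permutes A" "ncyc A p = 1" "x \<in> A"
  shows "orbit p x = A"
proof -
  obtain S where S: "orbit p ` A = {S}"
    using assms(3) card_1_singletonE unfolding ncyc_def by metis
  have "y \<in> orbit p x" if "y \<in> A" for y
  proof -
    have "orbit p y = S" "orbit p x = S" using S that assms(4) by auto
    then show ?thesis using permutes_self_in_orbit[OF assms(1,2), of y] by simp
  qed
  then show ?thesis using permutes_orbit_subset[OF assms(2,4)] by auto
qed

text \<open>Fixed points are allowed because the inductions below strip transpositions off an
  involution while the set \<open>A\<close> stays the same.\<close>

definition involution_on :: "'a set \<Rightarrow> ('a \<Rightarrow> 'a) \<Rightarrow> bool" where
  "involution_on A f \<longleftrightarrow> f permutes A \<and> (\<forall>x. f (f x) = x)"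

lemma involution_on_remove_pair:
  assumes f: "involution_on A f" and "f a = b" "a \<noteq> b"
  defines "g \<equiv> transpose a b \<circ> f"
  shows "involution_on (A - {a, b}) g" "{x \<in> A. g x \<noteq> x} = {x \<in> A. f x \<noteq> x} - {a, b}"
    "f \<circ> transpose a b = g" "f = transpose a b \<circ> g" "a \<in> A" "b \<in> A"
proof -
  have ff: "f (f x) = x" and perm: "f permutes A" for x using f by (auto simp: involution_on_def)
  have fb: "f b = a" using ff assms(2) by auto
  have eq: "f x = f y \<longleftrightarrow> x = y" for x y using ff by metis
  show in_A: "a \<in> A" "b \<in> A" using perm assms(2,3) fb by (metis permutes_not_in)+
  have g: "g x = (if x = a then a else if x = b then b else f x)" for x
  proof -
    have "f x = a \<longleftrightarrow> x = b" "f x = b \<longleftrightarrow> x = a" using eq assms(2) fb by metis+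
    then show ?thesis using assms(3) by (auto simp: g_def transpose_def)
  qed
  show "f \<circ> transpose a b = g" using assms(2) fb by (auto simp: g transpose_def fun_eq_iff)
  show "f = transpose a b \<circ> g" by (auto simp: g_def fun_eq_iff)
  have gg: "g (g x) = x" for x using ff assms(2) fb eq by (simp add: g) metis
  have "g x = x" if "x \<notin> A - {a, b}" for x
    using that perm by (auto simp: g permutes_not_in)
  moreover have "\<exists>!x. g x = y" for y using gg by metis
  ultimately show "involution_on (A - {a, b}) g" using gg by (simp add: involution_on_def permutes_def)
  show "{x \<in> A. g x \<noteq> x} = {x \<in> A. f x \<noteq> x} - {a, b}" by (auto simp: g)
qed

lemma involution_on_subset:
  "involution_on B f \<Longrightarrow> B \<subseteq> A \<Longrightarrow> involution_on A f"
  unfolding involution_on_def using permutes_subset by blast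

text \<open>\<open>f\<close> is a product of disjoint transpositions, half as many as the points it
  moves, and each of them creates at most one new cycle.\<close>

lemma ncyc_involution_comp_le:
  assumes "finite A" "p permutes A" "involution_on A f"
  shows "2 * ncyc A (f \<circ> p) \<le> 2 * ncyc A p + card {x \<in> A. f x \<noteq> x}"
  using assms(3)
proof (induction "card {x \<in> A. f x \<noteq> x}" arbitrary: f rule: less_induct)
  case less
  show ?case
  proof (cases "\<exists>a. f a \<noteq> a")
    case False
    then have "f = id" by auto
    then show ?thesis by simp
  next
    case True
    then obtain a b where ab: "f a = b" "a \<noteq> b" by metis
    define g where "g = transpose a b \<circ> f"
    note rem = involution_on_remove_pair[OF less.prems ab, folded g_def]
    have "b \<in> {x \<in> A. f x \<noteq> x}" "a \<in> {x \<in> A. f x \<noteq> x}"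
      using less.prems ab rem(5,6) unfolding involution_on_def by force+
    then have card: "card {x \<in> A. f x \<noteq> x} = card {x \<in> A. g x \<noteq> x} + 2"
      using rem(2) ab(2) card_Diff_subset[of "{a, b}" "{x \<in> A. f x \<noteq> x}"]
        card_mono[of "{x \<in> A. f x \<noteq> x}" "{a, b}"] assms(1) by simp
    have g: "involution_on A g" using rem(1) involution_on_subset by blast
    have "2 * ncyc A (g \<circ> p) \<le> 2 * ncyc A p + card {x \<in> A. g x \<noteq> x}"
      using less.hyps[OF _ g] card by simp
    moreover have "ncyc A (transpose a b \<circ> (g \<circ> p)) \<le> Suc (ncyc A (g \<circ> p))"
      using g assms rem(5,6) unfolding involution_on_def
      by (intro ncyc_transpose_le permutes_compose) auto
    moreover have "f \<circ> p = transpose a b \<circ> (g \<circ> p)" by (metis comp_assoc rem(4))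
    ultimately show ?thesis using card by simp
  qed
qed

text \<open>For permutations of a finite set, a set closed under \<open>p\<close> and
  \<open>f\<close> is closed under their inverses too, so this is transitivity of the generated
  group, stated without the group.\<close>

definition transitive_pair :: "'a set \<Rightarrow> ('a \<Rightarrow> 'a) \<Rightarrow> ('a \<Rightarrow> 'a) \<Rightarrow> bool" where
  "transitive_pair A p f \<longleftrightarrow>
     (\<forall>S\<subseteq>A. S \<noteq> {} \<longrightarrow> p ` S \<subseteq> S \<longrightarrow> f ` S \<subseteq> S \<longrightarrow> S = A)"

text \<open>Nonnegativity of the genus: as long as \<open>p\<close> has several cycles, transitivity yields a
  transposition of \<open>f\<close> joining two of them, which can be moved from \<open>f\<close> to \<open>p\<close>.\<close>

lemma transitive_pair_ncyc_le:
  assumes "finite A" "p permutes A" "involution_on A f" "transitive_pair A p f"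
  shows "2 * ncyc A (f \<circ> p) + 2 * ncyc A p \<le> card {x \<in> A. f x \<noteq> x} + 4"
  using assms(2-4)
proof (induction "ncyc A p" arbitrary: p f rule: less_induct)
  case less
  note p = less.prems(1) and f = less.prems(2) and trans = less.prems(3)
  show ?case
  proof (cases "\<exists>a. f a \<notin> orbit p a \<and> a \<in> A")
    case False
    \<comment> \<open>Here \<open>f\<close> preserves every cycle of \<open>p\<close>, so by
      transitivity each cycle is all of \<open>A\<close>. The bound for involutions then leaves
      \<open>4 * ncyc A p \<le> 4\<close>, the origin of the constant 4.\<close>
    have "ncyc A p \<le> 1"
    proof (cases "A = {}")
      case False
      have "orbit p x = A" if "x \<in> A" for x
      proof -
        have "f y \<in> orbit p x" if y: "y \<in> orbit p x" for y
          using \<open>\<nexists>a. f a \<notin> orbit p a \<and> a \<in> A\<close> permutes_orbit_eq[OF assms(1) p y]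
            permutes_orbit_subset[OF p \<open>x \<in> A\<close>] y by blast
        then show ?thesis
          using trans permutes_orbit_subset[OF p \<open>x \<in> A\<close>] orbit_nonempty[of p x]
            orbit_invariant[of p x] unfolding transitive_pair_def by blast
      qed
      then have "orbit p ` A = {A}" using False by auto
      then show ?thesis by (simp add: ncyc_def)
    qed (simp add: ncyc_def)
    then show ?thesis using ncyc_involution_comp_le[OF assms(1) p f] by simp
  next
    case True
    then obtain a b where ab: "f a = b" "b \<notin> orbit p a" by metis
    then have neq: "a \<noteq> b" using permutes_self_in_orbit[OF assms(1) p] by metis
    define g where "g = transpose a b \<circ> f"
    define q where "q = transpose a b \<circ> p"
    note rem = involution_on_remove_pair[OF f ab(1) neq, folded g_def]
    have "b \<in> {x \<in> A. f x \<noteq> x}" "a \<in> {x \<in> A. f x \<noteq> x}"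
      using f ab neq rem(5,6) unfolding involution_on_def by force+
    then have card: "card {x \<in> A. f x \<noteq> x} = card {x \<in> A. g x \<noteq> x} + 2"
      using rem(2) neq card_Diff_subset[of "{a, b}" "{x \<in> A. f x \<noteq> x}"]
        card_mono[of "{x \<in> A. f x \<noteq> x}" "{a, b}"] assms(1) by simp
    have g: "involution_on A g" using rem(1) involution_on_subset by blast
    have join: "ncyc A p = Suc (ncyc A q)"
      unfolding q_def using assms(1) p rem(5,6) ab(2) by (rule ncyc_transpose_join)
    have q: "q permutes A"
      unfolding q_def using assms(1) p rem(5,6) by (rule transpose_comp_permutes)
    have "b \<in> orbit q a"
      unfolding q_def using assms(1) p rem(5,6) ab(2) by (rule transpose_join_in_orbit)
    then have orb: "orbit q a = orbit q b" using permutes_orbit_eq[OF assms(1) q] by metis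
    \<comment> \<open>Since \<open>a\<close> and \<open>b\<close> lie on one cycle of
      \<open>q\<close>, a set invariant under \<open>q\<close> is closed under their transposition,
      hence invariant under the original \<open>p\<close> and \<open>f\<close> if it is also
      invariant under \<open>g\<close>.\<close>
    have "transitive_pair A q g"
      unfolding transitive_pair_def
    proof (intro allI impI)
      fix S assume S: "S \<subseteq> A" "S \<noteq> {}" "q ` S \<subseteq> S" "g ` S \<subseteq> S"
      have "a \<in> S \<longleftrightarrow> b \<in> S"
        using orbit_subset_invariant[OF _ S(3)] orb permutes_self_in_orbit[OF assms(1) q] by blast
      then have tS: "transpose a b ` S \<subseteq> S" by (auto simp: transpose_def)
      have "p = transpose a b \<circ> q" by (auto simp: q_def fun_eq_iff)
      then have "p ` S \<subseteq> S" using S(3) tS by fastforce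
      moreover have "f ` S \<subseteq> S"
        using S(4) tS by (subst rem(4)) fastforce
      ultimately show "S = A" using trans S unfolding transitive_pair_def by blast
    qed
    then have "2 * ncyc A (g \<circ> q) + 2 * ncyc A q \<le> card {x \<in> A. g x \<noteq> x} + 4"
      using less.hyps[OF _ q g] join by simp
    \<comment> \<open>The two copies of the transposition cancel. Passing to \<open>q\<close> and
      \<open>g\<close> thus lowers both sides of the inequality by 2.\<close>
    moreover have "g \<circ> q = f \<circ> p"
      unfolding q_def rem(3)[symmetric] by (auto simp: fun_eq_iff)
    ultimately show ?thesis using join card by simp
  qed
qed

section \<open>Splitting, rotating and shortening cycles given by lists\<close>

lemma cycle_of_list_append:
  "cycle_of_list (xs @ b # ys) = cycle_of_list (xs @ [b]) \<circ> cycle_of_list (b # ys)"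
proof (induction xs)
  case (Cons x xs)
  then show ?case by (cases xs) (auto simp: comp_assoc)
qed simp

lemma cycle_of_list_rotate_append:
  "distinct (xs @ ys) \<Longrightarrow> cycle_of_list (xs @ ys) = cycle_of_list (ys @ xs)"
  using cycle_of_list_rotate_independent[of "xs @ ys" "length xs"] by (simp add: rotate_append)

text \<open>Cutting at \<open>b\<close> gives the cycle of \<open>a # u @ [b]\<close> times that of
  \<open>b # v\<close>; the former, rotated to start with \<open>b\<close>, begins with the
  transposition of \<open>b\<close> and \<open>a\<close>. The identity serves both to split a face
  and to merge two faces.\<close>

lemma cycle_of_list_split:
  assumes "distinct (a # u @ b # v)"
  shows "cycle_of_list (a # u @ b # v)
    = transpose a b \<circ> cycle_of_list (a # u) \<circ> cycle_of_list (b # v)"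
proof -
  have "cycle_of_list ((a # u) @ [b]) = cycle_of_list ([b] @ a # u)"
    using assms by (intro cycle_of_list_rotate_append) auto
  then show ?thesis
    using cycle_of_list_append[of "a # u" b v] by (simp add: transpose_commute)
qed

lemma cycle_of_list_permutes: "set xs \<subseteq> A \<Longrightarrow> cycle_of_list xs permutes A"
  using cycle_permutes permutes_subset by blast

lemma ncyc_cycle_of_list:
  assumes "distinct xs" "xs \<noteq> []"
  shows "ncyc (set xs) (cycle_of_list xs) = 1"
  using assms
proof (induction xs rule: cycle_of_list.induct)
  case (1 i j cs)
  then have "ncyc (insert i (set (j # cs))) (transpose i j \<circ> cycle_of_list (j # cs))
      = ncyc (set (j # cs)) (cycle_of_list (j # cs))"
    by (intro ncyc_insert_transpose cycle_permutes) auto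
  then show ?case using 1 by (simp add: comp_def)
qed (simp_all add: ncyc_def)

lemma cycle_of_list_invariant_superset:
  assumes "distinct xs" "x \<in> S" "x \<in> set xs" "cycle_of_list xs ` (S \<inter> set xs) \<subseteq> S"
  shows "set xs \<subseteq> S"
proof -
  have "xs \<noteq> []" using assms by auto
  then have "orbit (cycle_of_list xs) x = set xs"
    using assms by (intro ncyc_eq_1_orbit cycle_permutes ncyc_cycle_of_list) auto
  moreover have "cycle_of_list xs ` (S \<inter> set xs) \<subseteq> S \<inter> set xs"
    using assms(4) permutes_in_image[OF cycle_permutes[of xs]] by auto
  then have "orbit (cycle_of_list xs) x \<subseteq> S \<inter> set xs"
    using assms by (intro orbit_subset_invariant) auto
  ultimately show ?thesis by auto
qed

text \<open>If \<open>u\<close> starts with \<open>j\<close>, the leading transposition of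
  \<open>a\<close> and \<open>j\<close> moves past \<open>q\<close>, which fixes \<open>a\<close>,
  and merely inserts \<open>a\<close> before \<open>q j\<close>. If \<open>u\<close> is empty,
  \<open>a\<close> is a fixed point of the whole product. The factor sits between \<open>q\<close>
  and \<open>r\<close> so that darts of any face can be removed in turn.\<close>

lemma ncyc_remove_dart:
  assumes "finite A" "q permutes A" "r permutes A" "set u \<subseteq> A" "a \<notin> A"
  shows "ncyc (insert a A) (q \<circ> cycle_of_list (a # u) \<circ> r)
    = ncyc A (q \<circ> cycle_of_list u \<circ> r) + (if u = [] then 1 else 0)"
proof (cases u)
  case Nil
  then show ?thesis
    using ncyc_insert_fixed[OF assms(1) permutes_compose[OF assms(3,2)] assms(5)] by simp
next
  case (Cons j cs)
  have qa: "q a = a" using assms by (simp add: permutes_not_in)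
  have "q \<circ> transpose a j = transpose a (q j) \<circ> q"
    using qa permutes_inj[OF assms(2)] by (auto simp: fun_eq_iff transpose_def inj_eq)
  then have "q \<circ> cycle_of_list (a # u) \<circ> r = transpose a (q j) \<circ> (q \<circ> cycle_of_list u \<circ> r)"
    using Cons by (simp add: comp_assoc[symmetric])
  moreover have "q \<circ> cycle_of_list u \<circ> r permutes A"
    using assms by (intro permutes_compose cycle_of_list_permutes)
  moreover have "q j \<in> A" using assms Cons by (simp add: permutes_in_image)
  ultimately show ?thesis
    using ncyc_insert_transpose[of A "q \<circ> cycle_of_list u \<circ> r" a "q j"] assms Cons by simp
qed

subsection \<open>Matchings and faces\<close>

definition matchings :: "'a set \<Rightarrow> ('a \<Rightarrow> 'a) set" where
  "matchings A = {f. involution_on A f \<and> (\<forall>x\<in>A. f x \<noteq> x)}"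

lemma matchingsD:
  assumes "f \<in> matchings A"
  shows "f permutes A" "f (f x) = x" "x \<in> A \<Longrightarrow> f x \<noteq> x" "x \<in> A \<Longrightarrow> f x \<in> A"
    "x \<notin> A \<Longrightarrow> f x = x" "involution_on A f" "{x \<in> A. f x \<noteq> x} = A"
  using assms by (auto simp: matchings_def involution_on_def permutes_in_image permutes_not_in)

lemma finite_matchings: "finite A \<Longrightarrow> finite (matchings A)"
  by (rule finite_subset[OF _ finite_permutations]) (auto dest: matchingsD)

lemma matchings_empty: "matchings {} = {id}"
  by (auto simp: matchings_def involution_on_def)

lemma matchings_compl_invariant:
  assumes "f \<in> matchings A" "S \<subseteq> A" "f ` S \<subseteq> S" "A - S = T"
  shows "f ` T \<subseteq> T"
proof
  fix y assume "y \<in> f ` T"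
  then obtain x where x: "x \<in> A" "x \<notin> S" "y = f x" using assms(4) by auto
  then have "f y = x" "y \<in> A" using matchingsD[OF assms(1)] by auto
  then show "y \<in> T" using assms(3,4) x by auto
qed

text \<open>Composition with the transposition of \<open>a\<close> and \<open>b\<close> is its own
  inverse and deletes or restores this pair. The arbitrary \<open>P\<close> carries planarity
  along.\<close>

lemma card_matchings_partner:
  assumes "a \<in> A" "b \<in> A" "a \<noteq> b"
  shows "card {f \<in> matchings A. f a = b \<and> P f}
    = card {g \<in> matchings (A - {a, b}). P (transpose a b \<circ> g)}"
proof -
  have fwd: "transpose a b \<circ> f \<in> matchings (A - {a, b})" if "f \<in> matchings A" "f a = b" for f
  proof -
    have f: "involution_on A f" "\<forall>x\<in>A. f x \<noteq> x" using that by (auto simp: matchings_def)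
    show ?thesis
      using involution_on_remove_pair(1,2)[OF f(1) that(2) assms(3)] f(2)
      unfolding matchings_def by blast
  qed
  have bwd: "transpose a b \<circ> g \<in> matchings A \<and> (transpose a b \<circ> g) a = b"
    if g: "g \<in> matchings (A - {a, b})" for g
  proof -
    note gD = matchingsD[OF g]
    have ga: "g a = a" "g b = b" using gD(5) by auto
    have gx: "g x \<noteq> a \<longleftrightarrow> x \<noteq> a" "g x \<noteq> b \<longleftrightarrow> x \<noteq> b" for x using ga gD(2) by metis+
    have "transpose a b \<circ> g permutes A"
      using assms gD(1) by (intro permutes_compose permutes_swap_id) (auto intro: permutes_subset)
    moreover have "transpose a b (g (transpose a b (g x))) = x" for x
      using ga gx gD(2) by (auto simp: transpose_def)
    moreover have "transpose a b (g x) \<noteq> x" if "x \<in> A" for x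
      using ga gx gD(3)[of x] that assms(3) by (auto simp: transpose_def)
    ultimately show ?thesis using ga by (simp add: matchings_def involution_on_def)
  qed
  have tt: "transpose a b \<circ> (transpose a b \<circ> f) = f" for f :: "'a \<Rightarrow> 'a" by (auto simp: fun_eq_iff)
  have "bij_betw (\<lambda>f. transpose a b \<circ> f) {f \<in> matchings A. f a = b \<and> P f}
      {g \<in> matchings (A - {a, b}). P (transpose a b \<circ> g)}"
    by (rule bij_betw_byWitness[where f' = "\<lambda>f. transpose a b \<circ> f"])
      (use fwd bwd tt in \<open>auto simp del: comp_apply\<close>)
  then show ?thesis by (rule bij_betw_same_card)
qed

lemma perm_restrict_matchings:
  assumes "f \<in> matchings A" "S \<subseteq> A" "f ` S \<subseteq> S"
  shows "perm_restrict f S \<in> matchings S"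
proof -
  have ff: "perm_restrict f S (perm_restrict f S x) = x" for x
    using matchingsD(2)[OF assms(1)] assms(3) by (auto simp: perm_restrict_def)
  then have "\<exists>!x. perm_restrict f S x = y" for y by metis
  then show ?thesis using ff matchingsD(3)[OF assms(1)] assms(2)
    by (auto simp: matchings_def involution_on_def permutes_def perm_restrict_def)
qed

text \<open>A matching that preserves \<open>U\<close> preserves \<open>W\<close> as well, so it is
  a free choice of one matching on each part.\<close>

lemma card_matchings_product:
  assumes "U \<inter> W = {}"
  shows "card {f \<in> matchings (U \<union> W). f ` U \<subseteq> U \<and> P (perm_restrict f U) \<and> Q (perm_restrict f W)}
    = card {f \<in> matchings U. P f} * card {f \<in> matchings W. Q f}"
proof -
  let ?L = "{f \<in> matchings (U \<union> W). f ` U \<subseteq> U \<and> P (perm_restrict f U) \<and> Q (perm_restrict f W)}"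
  let ?R = "{f \<in> matchings U. P f} \<times> {f \<in> matchings W. Q f}"
  have bwd: "f \<circ> g \<in> matchings (U \<union> W)" "\<forall>x\<in>U. (f \<circ> g) x \<in> U" "perm_restrict (f \<circ> g) U = f"
    "perm_restrict (f \<circ> g) W = g" if f: "f \<in> matchings U" and g: "g \<in> matchings W" for f g
  proof -
    note fD = matchingsD[OF f] and gD = matchingsD[OF g]
    have fg: "(f \<circ> g) x = (if x \<in> U then f x else g x)" for x
    proof (cases "x \<in> W")
      case True
      then have "g x \<notin> U" "x \<notin> U" using gD(4)[of x] assms by auto
      then show ?thesis using fD(5) by simp
    next
      case False
      then show ?thesis using fD(5)[of x] gD(5)[of x] by simp
    qed
    have "f \<circ> g permutes U \<union> W"
      using fD(1) gD(1) by (intro permutes_compose) (auto intro: permutes_subset)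
    moreover have "(f \<circ> g) ((f \<circ> g) x) = x" for x
    proof (cases "x \<in> U")
      case True
      then show ?thesis using fD(2,4) by (simp add: fg del: comp_apply)
    next
      case False
      then have "g x \<notin> U" using gD(4,5)[of x] assms by (cases "x \<in> W") auto
      then show ?thesis using False gD(2) by (simp add: fg del: comp_apply)
    qed
    moreover have "(f \<circ> g) x \<noteq> x" if "x \<in> U \<union> W" for x
      using fD(3)[of x] gD(3)[of x] that unfolding fg by auto
    ultimately show "f \<circ> g \<in> matchings (U \<union> W)" by (simp add: matchings_def involution_on_def)
    show "\<forall>x\<in>U. (f \<circ> g) x \<in> U" using fD(4) by (auto simp: fg simp del: comp_apply)
    show "perm_restrict (f \<circ> g) U = f" using fD(5) by (auto simp: perm_restrict_def fun_eq_iff fg simp del: comp_apply)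
    show "perm_restrict (f \<circ> g) W = g"
      using gD(5) assms by (auto simp: perm_restrict_def fun_eq_iff fg simp del: comp_apply)
  qed
  have fwd: "perm_restrict f U \<in> matchings U" "perm_restrict f W \<in> matchings W"
    "perm_restrict f U \<circ> perm_restrict f W = f" if f: "f \<in> matchings (U \<union> W)" "f ` U \<subseteq> U" for f
  proof -
    have fW: "f ` W \<subseteq> W" using matchings_compl_invariant[OF f(1) _ f(2)] assms by auto
    show "perm_restrict f U \<in> matchings U" "perm_restrict f W \<in> matchings W"
      using perm_restrict_matchings[OF f(1)] f(2) fW by auto
    show "perm_restrict f U \<circ> perm_restrict f W = f"
      using matchingsD(5)[OF f(1)] f(2) fW assms by (fastforce simp: perm_restrict_def fun_eq_iff)
  qed
  have "bij_betw (\<lambda>f. (perm_restrict f U, perm_restrict f W)) ?L ?R"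
    by (rule bij_betw_byWitness[where f' = "\<lambda>(f, g). f \<circ> g"])
      (use fwd bwd in \<open>auto simp del: comp_apply\<close>)
  then show ?thesis by (simp add: bij_betw_same_card card_cartesian_product)
qed

section \<open>Permutations given by lists of faces\<close>

definition faces_perm :: "'a list list \<Rightarrow> 'a \<Rightarrow> 'a" where
  "faces_perm fs = foldr (\<circ>) (map cycle_of_list fs) id"

lemma faces_perm_simps:
  "faces_perm [] = id" "faces_perm (xs # fs) = cycle_of_list xs \<circ> faces_perm fs"
  by (simp_all add: faces_perm_def)

lemma faces_perm_permutes: "set (concat fs) \<subseteq> A \<Longrightarrow> faces_perm fs permutes A"
  by (induction fs) (auto simp: faces_perm_simps permutes_id intro!: permutes_compose cycle_of_list_permutes)

lemma faces_perm_face: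
  assumes "distinct (concat fs)" "xs \<in> set fs" "x \<in> set xs"
  shows "faces_perm fs x = cycle_of_list xs x"
  using assms
proof (induction fs)
  case (Cons ys fs)
  show ?case
  proof (cases "x \<in> set ys")
    case True
    then have "xs = ys" using Cons.prems by fastforce
    moreover have "faces_perm fs x = x"
      using True Cons.prems faces_perm_permutes[of fs "set (concat fs)"]
      by (intro permutes_not_in[of _ "set (concat fs)"]) auto
    ultimately show ?thesis by (simp add: faces_perm_simps)
  next
    case False
    then have "xs \<in> set fs" using Cons.prems by auto
    moreover have "cycle_of_list xs x \<in> set xs"
      using Cons.prems(3) by (simp add: permutes_in_image[OF cycle_permutes])
    ultimately show ?thesis
      using Cons by (fastforce simp: faces_perm_simps intro!: id_outside_supp)
  qed
qed simp

lemma ncyc_faces_perm: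
  assumes "distinct (concat fs)" "[] \<notin> set fs"
  shows "ncyc (set (concat fs)) (faces_perm fs) = length fs"
  using assms
proof (induction fs)
  case (Cons xs fs)
  let ?p = "faces_perm (xs # fs)"
  have face: "?p x = cycle_of_list xs x" if "x \<in> set xs" for x
    using Cons.prems that by (intro faces_perm_face) auto
  have inv1: "cycle_of_list xs ` set xs = set xs" by (simp add: permutes_image cycle_permutes)
  have inv2: "faces_perm fs ` set (concat fs) = set (concat fs)"
    by (rule permutes_image[OF faces_perm_permutes]) simp
  have rest: "?p x = faces_perm fs x" if "x \<in> set (concat fs)" for x
  proof -
    have "faces_perm fs x \<in> set (concat fs)" using inv2 that by blast
    then have "faces_perm fs x \<notin> set xs" using Cons.prems by auto
    then show ?thesis by (simp add: faces_perm_simps id_outside_supp)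
  qed
  have img: "?p ` set xs = set xs" "?p ` set (concat fs) = set (concat fs)"
    using image_cong[OF refl face, of "set xs"] image_cong[OF refl rest, of "set (concat fs)"]
      inv1 inv2 by simp_all
  have "ncyc (set xs \<union> set (concat fs)) ?p = ncyc (set xs) ?p + ncyc (set (concat fs)) ?p"
    using Cons.prems img by (intro ncyc_Un) auto
  moreover have "ncyc (set xs) ?p = ncyc (set xs) (cycle_of_list xs)"
    using face inv1 by (intro ncyc_cong) auto
  moreover have "ncyc (set (concat fs)) ?p = ncyc (set (concat fs)) (faces_perm fs)"
    using rest inv2 by (intro ncyc_cong) auto
  moreover have "ncyc (set xs) (cycle_of_list xs) = 1"
    using Cons.prems by (intro ncyc_cycle_of_list) auto
  ultimately show ?case using Cons by simp
qed (simp add: ncyc_def)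

lemma faces_perm_invariant:
  assumes "distinct (concat fs)" "xs \<in> set fs" "faces_perm fs ` S \<subseteq> S" "S \<inter> set xs \<noteq> {}"
  shows "set xs \<subseteq> S"
proof -
  obtain x where "x \<in> S" "x \<in> set xs" using assms(4) by auto
  moreover have "cycle_of_list xs ` (S \<inter> set xs) \<subseteq> S"
    using faces_perm_face[OF assms(1,2)] assms(3) by force
  moreover have "distinct xs" using assms(1,2) by (auto simp: distinct_concat_iff)
  ultimately show ?thesis by (intro cycle_of_list_invariant_superset)
qed

text \<open>This is \<open>V - E + F \<le> 2\<close>, doubled, with \<open>V\<close> the number of
  cycles of the product and \<open>2 * E\<close> the number of labels. An empty face would raise
  \<open>length fs\<close> without providing a cycle.\<close>

lemma ncyc_faces_le:
  assumes "distinct (concat fs)" "[] \<notin> set fs" "f \<in> matchings (set (concat fs))"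
    "transitive_pair (set (concat fs)) (faces_perm fs) f"
  shows "2 * ncyc (set (concat fs)) (f \<circ> faces_perm fs) + 2 * length fs \<le> length (concat fs) + 4"
proof -
  have "2 * ncyc (set (concat fs)) (f \<circ> faces_perm fs) + 2 * ncyc (set (concat fs)) (faces_perm fs)
      \<le> card {x \<in> set (concat fs). f x \<noteq> x} + 4"
    using assms matchingsD[OF assms(3)] by (intro transitive_pair_ncyc_le faces_perm_permutes) auto
  then show ?thesis
    using assms(1) ncyc_faces_perm[OF assms(1,2)] matchingsD(7)[OF assms(3)] distinct_card by metis
qed

section \<open>Connectivity and vertex bounds for one, two and three faces\<close>

lemma transitive_one_face:
  assumes "distinct xs"
  shows "transitive_pair (set xs) (faces_perm [xs]) f"
  unfolding transitive_pair_def using faces_perm_invariant[of "[xs]" xs] assms by auto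

lemma ncyc_one_face_le:
  assumes "distinct xs" "xs \<noteq> []" "f \<in> matchings (set xs)"
  shows "2 * ncyc (set xs) (f \<circ> cycle_of_list xs) \<le> length xs + 2"
  using ncyc_faces_le[of "[xs]" f] transitive_one_face[of xs f] assms by (simp add: faces_perm_simps)

lemma transitive_two_faces:
  assumes "distinct (xs @ ys)" "f \<in> matchings (set xs \<union> set ys)" "\<not> f ` set xs \<subseteq> set xs"
  shows "transitive_pair (set xs \<union> set ys) (faces_perm [xs, ys]) f"
  unfolding transitive_pair_def
proof (intro allI impI)
  fix S assume S: "S \<subseteq> set xs \<union> set ys" "S \<noteq> {}" "faces_perm [xs, ys] ` S \<subseteq> S" "f ` S \<subseteq> S"
  have "S \<inter> set xs = {} \<or> set xs \<subseteq> S" "S \<inter> set ys = {} \<or> set ys \<subseteq> S"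
    using faces_perm_invariant[OF _ _ S(3)] assms(1) by auto
  moreover have "S = (S \<inter> set xs) \<union> (S \<inter> set ys)" using S(1) by blast
  ultimately have "S = {} \<or> S = set xs \<or> S = set ys \<or> S = set xs \<union> set ys"
    by (metis Int_absorb1 sup_bot.left_neutral sup_bot.right_neutral)
  moreover have "\<not> f ` set ys \<subseteq> set ys"
    using matchings_compl_invariant[OF assms(2), of "set ys" "set xs"] assms(1,3) by auto
  ultimately show "S = set xs \<union> set ys" using S(2,4) assms(3) by (elim disjE) simp_all
qed

lemma ncyc_two_faces_le:
  assumes "distinct (xs @ ys)" "f \<in> matchings (set xs \<union> set ys)" "\<not> f ` set xs \<subseteq> set xs"
  shows "2 * ncyc (set xs \<union> set ys) (f \<circ> cycle_of_list xs \<circ> cycle_of_list ys) \<le> length xs + length ys"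
proof -
  have "xs \<noteq> []" using assms(3) by auto
  moreover have "ys \<noteq> []" using assms(2,3) matchingsD(4)[OF assms(2)] by auto
  ultimately show ?thesis
    using ncyc_faces_le[of "[xs, ys]" f] transitive_two_faces[OF assms] assms
    by (simp add: faces_perm_simps comp_assoc)
qed

text \<open>Invariant sets are unions of faces. The complement of a set invariant under a matching
  is invariant, so the three hypotheses on \<open>f\<close> exclude all six proper nonempty unions.
  Euler's inequality with \<open>F = 3\<close> then reads
  \<open>2 * V + 6 \<le> 2 * E + 4\<close>.\<close>

lemma ncyc_three_faces_le:
  assumes "distinct (us @ vs @ ys)" "f \<in> matchings (set us \<union> set vs \<union> set ys)"
    "\<not> f ` set us \<subseteq> set us" "\<not> f ` set vs \<subseteq> set vs" "\<not> f ` (set us \<union> set vs) \<subseteq> set us \<union> set vs"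
  shows "2 * ncyc (set us \<union> set vs \<union> set ys)
      (f \<circ> cycle_of_list us \<circ> cycle_of_list vs \<circ> cycle_of_list ys) + 2
    \<le> length us + length vs + length ys"
proof -
  let ?A = "set us \<union> set vs \<union> set ys"
  have ne: "us \<noteq> []" "vs \<noteq> []" using assms(3,4) by auto
  have ney: "ys \<noteq> []"
  proof
    assume "ys = []"
    then have "f x \<in> set us \<union> set vs" if "x \<in> set us \<union> set vs" for x
      using matchingsD(4)[OF assms(2), of x] that by simp
    then show False using assms(5) by blast
  qed
  note comp = matchings_compl_invariant[OF assms(2)]
  have diff: "?A - set ys = set us \<union> set vs" "?A - (set us \<union> set ys) = set vs"
    "?A - (set vs \<union> set ys) = set us"
    using assms(1) by auto
  have no: "\<not> f ` set ys \<subseteq> set ys" "\<not> f ` (set us \<union> set ys) \<subseteq> set us \<union> set ys"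
    "\<not> f ` (set vs \<union> set ys) \<subseteq> set vs \<union> set ys"
    subgoal using assms(5) by (rule contrapos_nn) (rule comp[OF _ _ diff(1)], blast, assumption)
    subgoal using assms(4) by (rule contrapos_nn) (rule comp[OF _ _ diff(2)], blast, assumption)
    subgoal using assms(3) by (rule contrapos_nn) (rule comp[OF _ _ diff(3)], blast, assumption)
    done
  have distinct: "distinct (concat [us, vs, ys])" using assms(1) by simp
  have "transitive_pair ?A (faces_perm [us, vs, ys]) f"
    unfolding transitive_pair_def
  proof (intro allI impI)
    fix S assume S: "S \<subseteq> ?A" "S \<noteq> {}" "faces_perm [us, vs, ys] ` S \<subseteq> S" "f ` S \<subseteq> S"
    have cases: "S \<inter> set x \<in> {{}, set x}" if "x \<in> set [us, vs, ys]" for x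
      using faces_perm_invariant[OF distinct that S(3)] by blast
    have "S \<inter> set us \<in> {{}, set us}" "S \<inter> set vs \<in> {{}, set vs}" "S \<inter> set ys \<in> {{}, set ys}"
      by (rule cases, simp)+
    moreover have "S = (S \<inter> set us) \<union> (S \<inter> set vs) \<union> (S \<inter> set ys)" using S(1) by blast
    moreover have "B1 \<union> B2 \<union> B3 \<in> {{}, set us, set vs, set ys, set us \<union> set vs, set us \<union> set ys,
        set vs \<union> set ys, ?A}" if "B1 \<in> {{}, set us}" "B2 \<in> {{}, set vs}" "B3 \<in> {{}, set ys}" for B1 B2 B3
      using that by (elim insertE emptyE) simp_all
    ultimately have "S \<in> {{}, set us, set vs, set ys, set us \<union> set vs, set us \<union> set ys,
        set vs \<union> set ys, ?A}" by metis
    then show "S = ?A" using S(2,4) assms(3-5) no by (elim insertE emptyE) simp_all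
  qed
  then show ?thesis
    using ncyc_faces_le[of "[us, vs, ys]" f] assms ne ney
    by (simp add: faces_perm_simps comp_assoc Un_assoc)
qed

subsection \<open>Removing the edge of a dart\<close>

text \<open>The first alternative is the convention that the empty polygon is a sphere with one vertex, which
  has no dart on it. The first conjunct of \<open>planar2\<close> says that the two faces are connected.\<close>

definition planar1 :: "'a list \<Rightarrow> ('a \<Rightarrow> 'a) \<Rightarrow> bool" where
  "planar1 xs f \<longleftrightarrow> xs = [] \<or> 2 * ncyc (set xs) (f \<circ> cycle_of_list xs) = length xs + 2"

definition planar2 :: "'a list \<Rightarrow> 'a list \<Rightarrow> ('a \<Rightarrow> 'a) \<Rightarrow> bool" where
  "planar2 xs ys f \<longleftrightarrow> \<not> f ` set xs \<subseteq> set xs \<and>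
     2 * ncyc (set xs \<union> set ys) (f \<circ> cycle_of_list xs \<circ> cycle_of_list ys) = length xs + length ys"

definition count1 :: "'a list \<Rightarrow> nat" where
  "count1 xs = card {f \<in> matchings (set xs). planar1 xs f}"

definition count2 :: "'a list \<Rightarrow> 'a list \<Rightarrow> nat" where
  "count2 xs ys = card {f \<in> matchings (set xs \<union> set ys). planar2 xs ys f}"

text \<open>The cycles of \<open>vs\<close> and \<open>ys\<close> are trivial on \<open>us\<close>,
  and that of \<open>us\<close> is trivial on the rest, so the product falls apart into two
  independent permutations.\<close>

lemma ncyc_perm_restrict_Un:
  assumes "f \<in> matchings (set us \<union> (set vs \<union> set ys))" "distinct (us @ vs @ ys)" "f ` set us \<subseteq> set us"
  shows "ncyc (set us \<union> (set vs \<union> set ys)) (f \<circ> cycle_of_list us \<circ> cycle_of_list vs \<circ> cycle_of_list ys)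
    = ncyc (set us) (perm_restrict f (set us) \<circ> cycle_of_list us)
      + ncyc (set vs \<union> set ys)
          (perm_restrict f (set vs \<union> set ys) \<circ> cycle_of_list vs \<circ> cycle_of_list ys)"
proof -
  let ?U = "set us" and ?W = "set vs \<union> set ys"
  let ?p = "f \<circ> cycle_of_list us \<circ> cycle_of_list vs \<circ> cycle_of_list ys"
  let ?q = "perm_restrict f ?U \<circ> cycle_of_list us"
  let ?r = "perm_restrict f ?W \<circ> cycle_of_list vs \<circ> cycle_of_list ys"
  have disj: "?U \<inter> ?W = {}" using assms(2) by auto
  have fW: "f ` ?W \<subseteq> ?W"
    using matchings_compl_invariant[OF assms(1) _ assms(3)] disj by auto
  have "?q permutes ?U"
    using perm_restrict_matchings[OF assms(1) _ assms(3)]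
    by (intro permutes_compose cycle_permutes) (auto dest: matchingsD)
  then have qU: "?q ` ?U = ?U" by (rule permutes_image)
  have "?r permutes ?W"
    using perm_restrict_matchings[OF assms(1) _ fW]
    by (intro permutes_compose cycle_of_list_permutes) (auto dest: matchingsD)
  then have rW: "?r ` ?W = ?W" by (rule permutes_image)
  have pq: "?p x = ?q x" if "x \<in> ?U" for x
  proof -
    have "x \<notin> set vs" "x \<notin> set ys" using disj that by auto
    moreover have "cycle_of_list us x \<in> ?U" using that by (simp add: permutes_in_image[OF cycle_permutes])
    ultimately show ?thesis by (simp add: id_outside_supp perm_restrict_def)
  qed
  have pr: "?p x = ?r x" if "x \<in> ?W" for x
  proof -
    have "cycle_of_list vs \<circ> cycle_of_list ys permutes ?W"
      by (intro permutes_compose cycle_of_list_permutes) auto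
    then have "cycle_of_list vs (cycle_of_list ys x) \<in> ?W"
      using permutes_in_image that by fastforce
    moreover from this have "cycle_of_list vs (cycle_of_list ys x) \<notin> ?U" using disj by blast
    ultimately show ?thesis by (simp add: id_outside_supp perm_restrict_def)
  qed
  have "?p ` ?U \<subseteq> ?U" using image_cong[OF refl pq, of ?U] qU by simp
  moreover have "?p ` ?W \<subseteq> ?W" using image_cong[OF refl pr, of ?W] rW by simp
  ultimately have "ncyc (?U \<union> ?W) ?p = ncyc ?U ?p + ncyc ?W ?p"
    using disj by (intro ncyc_Un) auto
  moreover have "ncyc ?U ?p = ncyc ?U ?q" using pq qU by (intro ncyc_cong) auto
  moreover have "ncyc ?W ?p = ncyc ?W ?r" using pr rW by (intro ncyc_cong) auto
  ultimately show ?thesis by simp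
qed

text \<open>\<open>f\<close> fixes \<open>a\<close> and \<open>b\<close> and commutes with their
  transposition, which cancels against the one from \<open>cycle_of_list_split\<close>. What is left
  are separate faces \<open>a # us\<close> and \<open>b # vs\<close>, from which \<open>a\<close>
  and \<open>b\<close> are removed one at a time.\<close>

lemma ncyc_split_face:
  assumes "distinct (a # us @ b # vs @ ys)" "f \<in> matchings (set us \<union> (set vs \<union> set ys))"
  shows "ncyc (insert a (insert b (set us \<union> (set vs \<union> set ys))))
      (transpose a b \<circ> f \<circ> cycle_of_list (a # us @ b # vs) \<circ> cycle_of_list ys)
    = ncyc (set us \<union> (set vs \<union> set ys)) (f \<circ> cycle_of_list us \<circ> cycle_of_list vs \<circ> cycle_of_list ys)
      + (if us = [] then 1 else 0) + (if vs = [] then 1 else 0)"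
proof -
  let ?A = "set us \<union> (set vs \<union> set ys)"
  have perm: "f permutes ?A" using assms(2) by (rule matchingsD)
  have "f a = a" "f b = b" using matchingsD(5)[OF assms(2)] assms(1) by auto
  then have "transpose a b \<circ> f = f \<circ> transpose a b"
    using permutes_inj[OF perm] by (auto simp: fun_eq_iff transpose_def inj_eq)
  moreover have "cycle_of_list (a # us @ b # vs)
      = transpose a b \<circ> cycle_of_list (a # us) \<circ> cycle_of_list (b # vs)"
    using assms(1) by (intro cycle_of_list_split) auto
  ultimately have eq: "transpose a b \<circ> f \<circ> cycle_of_list (a # us @ b # vs) \<circ> cycle_of_list ys
      = f \<circ> cycle_of_list (a # us) \<circ> (cycle_of_list (b # vs) \<circ> cycle_of_list ys)"
    by (simp add: fun_eq_iff)
  have "ncyc (insert a (insert b ?A)) (f \<circ> cycle_of_list (a # us) \<circ> (cycle_of_list (b # vs) \<circ> cycle_of_list ys))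
      = ncyc (insert b ?A) (f \<circ> cycle_of_list us \<circ> (cycle_of_list (b # vs) \<circ> cycle_of_list ys))
        + (if us = [] then 1 else 0)"
    using assms(1) permutes_subset[OF perm, of "insert b ?A"]
    by (intro ncyc_remove_dart permutes_compose cycle_of_list_permutes) auto
  moreover have "ncyc (insert b ?A) ((f \<circ> cycle_of_list us) \<circ> cycle_of_list (b # vs) \<circ> cycle_of_list ys)
      = ncyc ?A ((f \<circ> cycle_of_list us) \<circ> cycle_of_list vs \<circ> cycle_of_list ys) + (if vs = [] then 1 else 0)"
    using assms(1) perm
    by (intro ncyc_remove_dart permutes_compose cycle_of_list_permutes) auto
  ultimately show ?thesis unfolding eq by (simp add: comp_assoc)
qed

lemma transpose_comp_invariant_iff:
  assumes "f a = a" "f b = b" "inj f" "a \<notin> S" "b \<notin> S"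
  shows "(transpose a b \<circ> f) ` insert a (insert b S) \<subseteq> insert a (insert b S) \<longleftrightarrow> f ` S \<subseteq> S"
proof -
  have "f x \<noteq> a" "f x \<noteq> b" if "x \<in> S" for x using assms that by (metis injD)+
  then have "(transpose a b \<circ> f) ` S = f ` S" by (auto simp: transpose_def image_iff)
  then show ?thesis using assms by auto (metis \<open>\<And>x. x \<in> S \<Longrightarrow> f x \<noteq> a\<close> \<open>\<And>x. x \<in> S \<Longrightarrow> f x \<noteq> b\<close> image_subset_iff insert_iff)
qed


text \<open>The vertices of the two components add up, and each component satisfies Euler's
  inequality. Equality for the sum therefore forces equality in both. The summand for
  \<open>us = []\<close> is the single vertex of the empty polygon.\<close>

lemma planar_invariant_face_iff:
  assumes "distinct (us @ vs @ ys)" "f \<in> matchings (set us \<union> (set vs \<union> set ys))"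
    "f ` set us \<subseteq> set us" "\<not> f ` set vs \<subseteq> set vs"
  shows "2 * (ncyc (set us \<union> (set vs \<union> set ys))
        (f \<circ> cycle_of_list us \<circ> cycle_of_list vs \<circ> cycle_of_list ys) + (if us = [] then 1 else 0))
      = length us + length vs + length ys + 2 \<longleftrightarrow>
    planar1 us (perm_restrict f (set us)) \<and> planar2 vs ys (perm_restrict f (set vs \<union> set ys))"
proof -
  let ?U = "set us" and ?W = "set vs \<union> set ys"
  have disj: "?U \<inter> ?W = {}" using assms(1) by auto
  have fW: "f ` ?W \<subseteq> ?W"
    using matchings_compl_invariant[OF assms(2) _ assms(3)] disj by auto
  have mU: "perm_restrict f ?U \<in> matchings ?U" and mW: "perm_restrict f ?W \<in> matchings ?W"
    using perm_restrict_matchings[OF assms(2)] assms(3) fW by auto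
  have "perm_restrict f ?W ` set vs = f ` set vs"
    by (intro image_cong) (auto simp: perm_restrict_def)
  with assms(4) have nV: "\<not> perm_restrict f ?W ` set vs \<subseteq> set vs" by simp
  have "2 * ncyc ?U (perm_restrict f ?U \<circ> cycle_of_list us) \<le> length us + 2" if "us \<noteq> []"
    using that assms(1) mU by (intro ncyc_one_face_le) auto
  moreover have "2 * ncyc ?W (perm_restrict f ?W \<circ> cycle_of_list vs \<circ> cycle_of_list ys)
      \<le> length vs + length ys"
    using assms(1) mW nV by (intro ncyc_two_faces_le) auto
  moreover have "ncyc ?U (perm_restrict f ?U \<circ> cycle_of_list us) = 0" if "us = []"
    using that by (simp add: ncyc_def)
  ultimately show ?thesis
    unfolding ncyc_perm_restrict_Un[OF assms(2,1,3)] planar1_def planar2_def using nV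
    by (cases "us = []") auto
qed

lemma planar2_split_iff:
  assumes dist: "distinct (a # us @ b # vs @ ys)" and f: "f \<in> matchings (set us \<union> (set vs \<union> set ys))"
  shows "planar2 (a # us @ b # vs) ys (transpose a b \<circ> f) \<longleftrightarrow>
    f ` set us \<subseteq> set us \<and> planar1 us (perm_restrict f (set us)) \<and>
      planar2 vs ys (perm_restrict f (set vs \<union> set ys)) \<or>
    f ` set vs \<subseteq> set vs \<and> planar1 vs (perm_restrict f (set vs)) \<and>
      planar2 us ys (perm_restrict f (set us \<union> set ys))"
    (is "?L \<longleftrightarrow> ?R1 \<or> ?R2")
proof -
  let ?n = "ncyc (set us \<union> (set vs \<union> set ys)) (f \<circ> cycle_of_list us \<circ> cycle_of_list vs \<circ> cycle_of_list ys)"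
  let ?k = "(if us = [] then 1 else 0) + (if vs = [] then 1 else 0)"
  have fab: "f a = a" "f b = b" using matchingsD(5)[OF f] dist by auto
  have inj: "inj f" using matchingsD(1)[OF f] by (rule permutes_inj)
  have ff: "f (f x) = x" for x using f by (rule matchingsD)
  have set_eq: "set (a # us @ b # vs) = insert a (insert b (set us \<union> set vs))"
    "set (a # us @ b # vs) \<union> set ys = insert a (insert b (set us \<union> (set vs \<union> set ys)))" by auto
  have inv: "(transpose a b \<circ> f) ` set (a # us @ b # vs) \<subseteq> set (a # us @ b # vs)
      \<longleftrightarrow> f ` (set us \<union> set vs) \<subseteq> set us \<union> set vs"
    unfolding set_eq(1) using dist by (intro transpose_comp_invariant_iff[OF fab inj]) auto
  have "length (a # us @ b # vs) + length ys = length us + length vs + length ys + 2" by simp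
  then have L: "?L \<longleftrightarrow> \<not> f ` (set us \<union> set vs) \<subseteq> set us \<union> set vs \<and>
      2 * (?n + ?k) = length us + length vs + length ys + 2"
    unfolding planar2_def inv set_eq(2) ncyc_split_face[OF dist f] by (simp only: add.assoc)
  have restr: "perm_restrict f (set us \<union> set ys) ` set us = f ` set us"
    "perm_restrict f (set vs \<union> set ys) ` set vs = f ` set vs"
    by (intro image_cong; auto simp: perm_restrict_def)+
  have R1: "?R1 \<Longrightarrow> \<not> f ` set vs \<subseteq> set vs" and R2: "?R2 \<Longrightarrow> \<not> f ` set us \<subseteq> set us"
    by (auto simp: planar2_def restr)
  have diff: "f ` (set us \<union> set vs) \<subseteq> set us \<union> set vs \<longleftrightarrow> f ` set vs \<subseteq> set vs" if "f ` set us \<subseteq> set us"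
  proof -
    have "f x \<notin> set us" if "x \<in> set vs" for x
    proof
      assume "f x \<in> set us"
      then have "f (f x) \<in> set us" using \<open>f ` set us \<subseteq> set us\<close> by blast
      then show False using that dist ff by auto
    qed
    then show ?thesis using that by blast
  qed
  have diff': "f ` (set us \<union> set vs) \<subseteq> set us \<union> set vs \<longleftrightarrow> f ` set us \<subseteq> set us" if "f ` set vs \<subseteq> set vs"
  proof -
    have "f x \<notin> set vs" if "x \<in> set us" for x
    proof
      assume "f x \<in> set vs"
      then have "f (f x) \<in> set vs" using \<open>f ` set vs \<subseteq> set vs\<close> by blast
      then show False using that dist ff by auto
    qed
    then show ?thesis using that by blast
  qed
  consider "f ` set us \<subseteq> set us" "f ` set vs \<subseteq> set vs" | "f ` set us \<subseteq> set us" "\<not> f ` set vs \<subseteq> set vs"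
    | "\<not> f ` set us \<subseteq> set us" "f ` set vs \<subseteq> set vs" | "\<not> f ` set us \<subseteq> set us" "\<not> f ` set vs \<subseteq> set vs"
    by blast
  then show ?thesis
  proof cases
    \<comment> \<open>Both parts are glued to themselves: nothing is connected to \<open>ys\<close>,
      and all three statements fail.\<close>
    case 1
    then show ?thesis using L R1 R2 diff by blast
  next
    case 2
    then have "vs \<noteq> []" by auto
    moreover have "distinct (us @ vs @ ys)" using dist by auto
    ultimately have "2 * (?n + ?k) = length us + length vs + length ys + 2 \<longleftrightarrow> ?R1"
      using planar_invariant_face_iff[OF _ f 2] 2(1) by simp
    then show ?thesis using 2 L R2 diff by blast
  next
    \<comment> \<open>Disjoint cycles commute, so this is the previous case with \<open>us\<close>
      and \<open>vs\<close> exchanged.\<close>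
    case 3
    then have ne: "us \<noteq> []" by auto
    have dist': "distinct (vs @ us @ ys)" using dist by auto
    have "cycle_of_list us \<circ> cycle_of_list vs = cycle_of_list vs \<circ> cycle_of_list us"
      using dist by (intro cycles_commute) auto
    then have "f \<circ> cycle_of_list us \<circ> cycle_of_list vs = f \<circ> cycle_of_list vs \<circ> cycle_of_list us"
      by (simp add: comp_assoc)
    moreover have Un: "set us \<union> (set vs \<union> set ys) = set vs \<union> (set us \<union> set ys)" by auto
    ultimately have "2 * (?n + ?k) = length us + length vs + length ys + 2 \<longleftrightarrow> ?R2"
      using planar_invariant_face_iff[OF dist' f[unfolded Un] 3(2,1)] 3(2) ne by (simp add: add_ac)
    then show ?thesis using 3 L R1 diff' by blast
  next
    \<comment> \<open>Under the left-hand side the three faces would form a connected gluing. Since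
      no part is empty, it would need \<open>2 * E + 2\<close> as twice its vertex number, where
      Euler's inequality allows only \<open>2 * E - 2\<close>.\<close>
    case 4
    then have ne: "us \<noteq> []" "vs \<noteq> []" by auto
    have "\<not> ?L"
    proof
      assume ?L
      then have n: "\<not> f ` (set us \<union> set vs) \<subseteq> set us \<union> set vs"
        "2 * (?n + ?k) = length us + length vs + length ys + 2" using L by blast+
      have "2 * ?n + 2 \<le> length us + length vs + length ys"
        using ncyc_three_faces_le[OF _ _ 4 n(1), of ys] dist f by (simp add: Un_assoc)
      then show False using n(2) ne by simp
    qed
    then show ?thesis using 4 by blast
  qed
qed

text \<open>With the second face rotated to start at \<open>b\<close>, the splitting identity is
  read backwards and yields one face. Removing \<open>a\<close>, rotating \<open>b\<close> to the
  front and removing it leaves the cyclic word \<open>vs @ us @ xs\<close>. Connectivity is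
  automatic because \<open>a\<close> is paired with \<open>b\<close>.\<close>

lemma planar2_join_iff:
  assumes dist: "distinct (a # xs @ us @ b # vs)" and f: "f \<in> matchings (set (vs @ us @ xs))"
  shows "planar2 (a # xs) (us @ b # vs) (transpose a b \<circ> f) \<longleftrightarrow> planar1 (vs @ us @ xs) f"
proof -
  let ?w = "vs @ us @ xs"
  have perm: "f permutes set ?w" using f by (rule matchingsD)
  have fab: "f a = a" "f b = b" using matchingsD(5)[OF f] dist by auto
  have t: "transpose a b \<circ> f = f \<circ> transpose a b"
    using fab permutes_inj[OF perm] by (auto simp: fun_eq_iff transpose_def inj_eq)
  have rot: "cycle_of_list (us @ b # vs) = cycle_of_list (b # vs @ us)"
    using cycle_of_list_rotate_append[of us "b # vs"] dist by simp
  have join: "cycle_of_list (a # xs @ b # vs @ us)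
      = transpose a b \<circ> cycle_of_list (a # xs) \<circ> cycle_of_list (b # vs @ us)"
    using dist by (intro cycle_of_list_split) auto
  have rot': "cycle_of_list (xs @ b # vs @ us) = cycle_of_list (b # ?w)"
    using cycle_of_list_rotate_append[of xs "b # vs @ us"] dist by auto
  have eq: "transpose a b \<circ> f \<circ> cycle_of_list (a # xs) \<circ> cycle_of_list (us @ b # vs)
      = f \<circ> cycle_of_list (a # xs @ b # vs @ us) \<circ> id"
    unfolding rot join t by (simp add: comp_assoc)
  have "ncyc (insert a (insert b (set ?w))) (f \<circ> cycle_of_list (a # xs @ b # vs @ us) \<circ> id)
      = ncyc (insert b (set ?w)) (f \<circ> cycle_of_list (xs @ b # vs @ us) \<circ> id)
        + (if xs @ b # vs @ us = [] then 1 else 0)"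
    using dist permutes_subset[OF perm, of "insert b (set ?w)"]
    by (intro ncyc_remove_dart) (auto simp: permutes_id)
  also have "\<dots> = ncyc (insert b (set ?w)) (f \<circ> cycle_of_list (b # ?w) \<circ> id)"
    unfolding rot' by simp
  also have "\<dots> = ncyc (set ?w) (f \<circ> cycle_of_list ?w \<circ> id) + (if ?w = [] then 1 else 0)"
    using dist perm by (intro ncyc_remove_dart) (auto simp: permutes_id)
  finally have n: "ncyc (insert a (insert b (set ?w)))
      (transpose a b \<circ> f \<circ> cycle_of_list (a # xs) \<circ> cycle_of_list (us @ b # vs))
    = ncyc (set ?w) (f \<circ> cycle_of_list ?w) + (if ?w = [] then 1 else 0)"
    unfolding eq by simp
  have set_eq: "set (a # xs) \<union> set (us @ b # vs) = insert a (insert b (set ?w))" by auto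
  have "(transpose a b \<circ> f) a = b" using fab by simp
  then have "\<not> (transpose a b \<circ> f) ` set (a # xs) \<subseteq> set (a # xs)" using dist by auto
  then have "planar2 (a # xs) (us @ b # vs) (transpose a b \<circ> f) \<longleftrightarrow>
      2 * (ncyc (set ?w) (f \<circ> cycle_of_list ?w) + (if ?w = [] then 1 else 0)) = length ?w + 2"
    unfolding planar2_def set_eq n by auto
  \<comment> \<open>For the empty word the left-hand side is \<open>2 * (0 + 1) = 0 + 2\<close>, in
    agreement with the convention in \<open>planar1\<close>.\<close>
  also have "\<dots> \<longleftrightarrow> planar1 ?w f" by (cases "?w = []") (auto simp: planar1_def ncyc_def)
  finally show ?thesis .
qed

subsection \<open>Counting planar matchings\<close>

lemma count2_partner_same_face:
  assumes "distinct (a # us @ b # vs @ ys)"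
  shows "card {f \<in> matchings (set (a # us @ b # vs) \<union> set ys). f a = b \<and> planar2 (a # us @ b # vs) ys f}
    = count1 us * count2 vs ys + count1 vs * count2 us ys"
proof -
  let ?A = "set us \<union> (set vs \<union> set ys)"
  let ?R1 = "{f \<in> matchings ?A. f ` set us \<subseteq> set us \<and> planar1 us (perm_restrict f (set us)) \<and>
      planar2 vs ys (perm_restrict f (set vs \<union> set ys))}"
  let ?R2 = "{f \<in> matchings ?A. f ` set vs \<subseteq> set vs \<and> planar1 vs (perm_restrict f (set vs)) \<and>
      planar2 us ys (perm_restrict f (set us \<union> set ys))}"
  have A: "set (a # us @ b # vs) \<union> set ys - {a, b} = ?A" using assms by auto
  have "card {f \<in> matchings (set (a # us @ b # vs) \<union> set ys). f a = b \<and> planar2 (a # us @ b # vs) ys f}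
      = card {f \<in> matchings ?A. planar2 (a # us @ b # vs) ys (transpose a b \<circ> f)}"
    unfolding A[symmetric] using assms by (intro card_matchings_partner) auto
  also have "{f \<in> matchings ?A. planar2 (a # us @ b # vs) ys (transpose a b \<circ> f)} = ?R1 \<union> ?R2"
    using planar2_split_iff[OF assms] by blast
  also have "card (?R1 \<union> ?R2) = card ?R1 + card ?R2"
  proof (rule card_Un_disjoint)
    \<comment> \<open>In \<open>?R1\<close> the gluing of \<open>vs\<close> and \<open>ys\<close> is
      connected, so \<open>vs\<close> is not invariant; in \<open>?R2\<close> it is.\<close>
    have "perm_restrict f (set vs \<union> set ys) ` set vs = f ` set vs" for f :: "'a \<Rightarrow> 'a"
      by (intro image_cong) (auto simp: perm_restrict_def)
    then show "?R1 \<inter> ?R2 = {}" unfolding planar2_def by auto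
  qed (rule finite_subset[OF _ finite_matchings[of ?A]]; auto)+
  also have "card ?R1 = count1 us * count2 vs ys"
    unfolding count1_def count2_def using assms by (intro card_matchings_product) auto
  also have "card ?R2 = count1 vs * count2 us ys"
  proof -
    have "set vs \<inter> (set us \<union> set ys) = {}" using assms by auto
    moreover have "?A = set vs \<union> (set us \<union> set ys)" by auto
    ultimately show ?thesis unfolding count1_def count2_def by (simp only: card_matchings_product)
  qed
  finally show ?thesis .
qed

lemma count2_partner_other_face:
  assumes "distinct (a # xs @ us @ b # vs)"
  shows "card {f \<in> matchings (set (a # xs) \<union> set (us @ b # vs)). f a = b \<and> planar2 (a # xs) (us @ b # vs) f}
    = count1 (vs @ us @ xs)"
proof -
  have A: "set (a # xs) \<union> set (us @ b # vs) - {a, b} = set (vs @ us @ xs)" using assms by auto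
  have "card {f \<in> matchings (set (a # xs) \<union> set (us @ b # vs)). f a = b \<and> planar2 (a # xs) (us @ b # vs) f}
      = card {f \<in> matchings (set (vs @ us @ xs)). planar2 (a # xs) (us @ b # vs) (transpose a b \<circ> f)}"
    unfolding A[symmetric] using assms by (intro card_matchings_partner) auto
  also have "\<dots> = count1 (vs @ us @ xs)"
    unfolding count1_def using planar2_join_iff[OF assms] by (metis (no_types, lifting) Collect_cong)
  finally show ?thesis .
qed

lemma sum_set_conv_nth:
  assumes "distinct xs"
  shows "sum g (set xs) = (\<Sum>i<length xs. g (xs ! i))"
  using sum.reindex_bij_betw[OF bij_betw_nth[OF assms refl refl], of g] by simp

lemma count2_rec:
  assumes dist: "distinct (a # xs @ ys)"
  shows "count2 (a # xs) ys =
    (\<Sum>i<length xs. count1 (take i xs) * count2 (drop (Suc i) xs) ys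
      + count1 (drop (Suc i) xs) * count2 (take i xs) ys)
    + (\<Sum>j<length ys. count1 (drop (Suc j) ys @ take j ys @ xs))"
proof -
  let ?A = "set (a # xs) \<union> set ys"
  let ?D = "\<lambda>b. {f \<in> matchings ?A. f a = b \<and> planar2 (a # xs) ys f}"
  have "f a \<in> set xs \<union> set ys" if "f \<in> matchings ?A" for f
    using matchingsD(3,4)[OF that, of a] by auto
  then have "{f \<in> matchings ?A. planar2 (a # xs) ys f} = (\<Union>b\<in>set xs \<union> set ys. ?D b)" by auto
  then have "count2 (a # xs) ys = card (\<Union>b\<in>set xs \<union> set ys. ?D b)" by (simp add: count2_def)
  also have "\<dots> = (\<Sum>b\<in>set xs \<union> set ys. card (?D b))"
    by (rule card_UN_disjoint) (auto intro: finite_subset[OF _ finite_matchings[of ?A]])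
  also have "\<dots> = (\<Sum>b\<in>set xs. card (?D b)) + (\<Sum>b\<in>set ys. card (?D b))"
    using dist by (intro sum.union_disjoint) auto
  also have "(\<Sum>b\<in>set xs. card (?D b)) = (\<Sum>i<length xs. count1 (take i xs) * count2 (drop (Suc i) xs) ys
      + count1 (drop (Suc i) xs) * count2 (take i xs) ys)"
  proof -
    have "card (?D (xs ! i)) = count1 (take i xs) * count2 (drop (Suc i) xs) ys
      + count1 (drop (Suc i) xs) * count2 (take i xs) ys" if "i < length xs" for i
    proof -
      have eq: "xs = take i xs @ xs ! i # drop (Suc i) xs" using that by (rule id_take_nth_drop)
      have "distinct (a # (take i xs @ xs ! i # drop (Suc i) xs) @ ys)"
        using dist by (simp only: eq[symmetric])
      then show ?thesis
        using count2_partner_same_face[of a "take i xs" "xs ! i" "drop (Suc i) xs" ys, folded eq]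
        by simp
    qed
    then show ?thesis using dist by (simp add: sum_set_conv_nth)
  qed
  also have "(\<Sum>b\<in>set ys. card (?D b)) = (\<Sum>j<length ys. count1 (drop (Suc j) ys @ take j ys @ xs))"
  proof -
    have "card (?D (ys ! j)) = count1 (drop (Suc j) ys @ take j ys @ xs)" if "j < length ys" for j
    proof -
      have "ys = take j ys @ ys ! j # drop (Suc j) ys" using that by (rule id_take_nth_drop)
      then show ?thesis
        using count2_partner_other_face[of a xs "take j ys" "ys ! j" "drop (Suc j) ys"] dist
        by (simp only:)
    qed
    then show ?thesis using dist by (simp add: sum_set_conv_nth)
  qed
  finally show ?thesis .
qed

section \<open>Invariance of the counts under relabelling\<close>

lemma ex_bij_map_eq:
  fixes xs ys :: "'a list"
  assumes "distinct xs" "distinct ys" "length xs = length ys"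
  shows "\<exists>h. bij h \<and> map h xs = ys"
  using assms
proof (induction xs arbitrary: ys)
  case Nil
  then show ?case by (auto intro: exI[of _ id])
next
  case (Cons x xs)
  then obtain y zs where ys: "ys = y # zs" by (cases ys) auto
  then obtain h where h: "bij h" "map h xs = zs" using Cons by auto
  have "h x' \<noteq> h x" "h x' \<noteq> y" if "x' \<in> set xs" for x'
  proof -
    show "h x' \<noteq> h x" using that Cons.prems(1) bij_is_inj[OF h(1)] by (auto dest: injD)
    have "h x' \<in> set zs" using that h(2) by auto
    then show "h x' \<noteq> y" using Cons.prems(2) ys by auto
  qed
  then have "map (transpose (h x) y \<circ> h) (x # xs) = ys"
    using h(2) by (auto simp: ys transpose_def)
  moreover have "bij (transpose (h x) y \<circ> h)" using h(1) by (intro bij_comp) auto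
  ultimately show ?case by blast
qed

lemma conj_matchings:
  fixes h :: "'a \<Rightarrow> 'a"
  assumes "bij h" "f \<in> matchings A"
  shows "h \<circ> f \<circ> inv' h \<in> matchings (h ` A)"
proof -
  let ?g = "h \<circ> f \<circ> inv' h"
  have inv: "inv' h (h x) = x" "h (inv' h x) = x" for x
    using assms(1) by (simp_all add: bij_is_inj bij_is_surj surj_f_inv_f)
  have eq: "h x = h y \<longleftrightarrow> x = y" for x y using inv by metis
  have gg: "?g (?g x) = x" for x using matchingsD(2)[OF assms(2)] by (simp add: inv)
  then have "\<exists>!x. ?g x = y" for y by metis
  moreover have "?g x = x" if "x \<notin> h ` A" for x
  proof -
    have "inv' h x \<notin> A" using that inv(2) by (metis imageI)
    then show ?thesis using matchingsD(5)[OF assms(2)] by (simp add: inv)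
  qed
  moreover have "?g x \<noteq> x" if "x \<in> h ` A" for x
    using that matchingsD(3)[OF assms(2)] by (auto simp: inv eq)
  ultimately show ?thesis using gg by (simp add: matchings_def involution_on_def permutes_def)
qed

lemma conj_inj:
  fixes h :: "'a \<Rightarrow> 'a"
  assumes "bij h"
  shows "inj_on (\<lambda>f. h \<circ> f \<circ> inv' h) S"
proof (rule inj_onI)
  fix f g assume eq: "h \<circ> f \<circ> inv' h = h \<circ> g \<circ> inv' h"
  show "f = g"
  proof
    fix x
    have "h (f (inv' h (h x))) = h (g (inv' h (h x)))" using eq by (metis comp_apply)
    then show "f x = g x" using bij_is_inj[OF assms] by (simp add: inj_eq)
  qed
qed

lemma ncyc_conj_cycles:
  fixes h :: "'a \<Rightarrow> 'a"
  assumes "bij h" "distinct xs" "distinct ys"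
  shows "ncyc (h ` A) (h \<circ> f \<circ> inv' h \<circ> cycle_of_list (map h xs) \<circ> cycle_of_list (map h ys))
    = ncyc A (f \<circ> cycle_of_list xs \<circ> cycle_of_list ys)"
proof -
  have "h \<circ> f \<circ> inv' h \<circ> cycle_of_list (map h xs) \<circ> cycle_of_list (map h ys)
      = h \<circ> (f \<circ> cycle_of_list xs \<circ> cycle_of_list ys) \<circ> inv' h"
    using bij_is_inj[OF assms(1)]
    by (simp add: conjugation_of_cycle[OF assms(2,1), symmetric]
        conjugation_of_cycle[OF assms(3,1), symmetric] fun_eq_iff)
  then show ?thesis using ncyc_conj[OF assms(1)] by metis
qed

text \<open>Conjugation by a relabelling is injective and preserves planarity. This gives one
  inequality; since the hypotheses are symmetric in the two lists, equality follows.\<close>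

lemma count1_le:
  fixes xs ys :: "'a list"
  assumes "distinct xs" "distinct ys" "length xs = length ys"
  shows "count1 xs \<le> count1 ys"
proof -
  obtain h where h: "bij h" "map h xs = ys" using ex_bij_map_eq[OF assms] by blast
  have set: "set ys = h ` set xs" using h(2) by auto
  show ?thesis unfolding count1_def
  proof (rule card_inj_on_le[OF conj_inj[OF h(1)]])
    show "(\<lambda>f. h \<circ> f \<circ> inv' h) ` {f \<in> matchings (set xs). planar1 xs f}
        \<subseteq> {f \<in> matchings (set ys). planar1 ys f}"
      \<comment> \<open>An empty second list has the identity as its cycle, which reduces the
        statement on two faces to one face.\<close>
      using conj_matchings[OF h(1)] ncyc_conj_cycles[OF h(1) assms(1), of "[]"]
        assms(3) h(2) by (auto simp: planar1_def set simp del: comp_apply)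
  qed (simp add: finite_matchings)
qed

lemma count2_le:
  fixes xs ys xs' ys' :: "'a list"
  assumes "distinct (xs @ ys)" "distinct (xs' @ ys')" "length xs = length xs'" "length ys = length ys'"
  shows "count2 xs ys \<le> count2 xs' ys'"
proof -
  obtain h where h: "bij h" "map h (xs @ ys) = xs' @ ys'"
    using ex_bij_map_eq[OF assms(1,2)] assms(3,4) by auto
  then have map: "map h xs = xs'" "map h ys = ys'" using assms(3) by auto
  have img: "(h \<circ> f \<circ> inv' h) ` set xs' \<subseteq> set xs' \<longleftrightarrow> f ` set xs \<subseteq> set xs" for f
  proof -
    have "inv' h (h x) = x" for x using h(1) by (simp add: bij_is_inj)
    then have "(h \<circ> f \<circ> inv' h) ` set xs' = h ` f ` set xs"
      by (auto simp: map(1)[symmetric] image_image)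
    moreover have "set xs' = h ` set xs" using map(1) by auto
    ultimately show ?thesis using bij_is_inj[OF h(1)] by (simp add: inj_image_subset_iff)
  qed
  have set: "set xs' \<union> set ys' = h ` (set xs \<union> set ys)" using map by auto
  show ?thesis unfolding count2_def
  proof (rule card_inj_on_le[OF conj_inj[OF h(1)]])
    show "(\<lambda>f. h \<circ> f \<circ> inv' h) ` {f \<in> matchings (set xs \<union> set ys). planar2 xs ys f}
        \<subseteq> {f \<in> matchings (set xs' \<union> set ys'). planar2 xs' ys' f}"
    proof (rule image_subsetI)
      fix f assume "f \<in> {f \<in> matchings (set xs \<union> set ys). planar2 xs ys f}"
      then show "h \<circ> f \<circ> inv' h \<in> {f \<in> matchings (set xs' \<union> set ys'). planar2 xs' ys' f}"
        using conj_matchings[OF h(1)] ncyc_conj_cycles[OF h(1), of xs ys] assms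
        by (simp add: planar2_def set map img del: comp_apply)
    qed
  qed (simp add: finite_matchings)
qed

lemma count1_length:
  fixes xs ys :: "'a list"
  assumes "distinct xs" "distinct ys" "length xs = length ys"
  shows "count1 xs = count1 ys"
  using assms by (intro le_antisym count1_le) simp_all

lemma count2_length:
  fixes xs ys xs' ys' :: "'a list"
  assumes "distinct (xs @ ys)" "distinct (xs' @ ys')" "length xs = length xs'" "length ys = length ys'"
  shows "count2 xs ys = count2 xs' ys'"
  using assms by (intro le_antisym count2_le) simp_all

subsection \<open>Gluing data\<close>

text \<open>A set invariant under the generators is invariant under the group and so contains the
  whole orbit of any of its points; conversely, each group orbit is invariant under the
  generators.\<close>

lemma connected_gluing_iff_transitive_pair:
  assumes "f permutes {1..2 * N}" "face_perm ms permutes {1..2 * N}"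
  shows "connected_gluing N (ms, f) \<longleftrightarrow> transitive_pair {1..2 * N} (face_perm ms) f"
proof
  let ?A = "{1..2 * N}" and ?H = "{f, face_perm ms}"
  let ?G = "generate (sym_group (2 * N)) ?H"
  have H: "?H \<subseteq> carrier (sym_group (2 * N))" using assms by (simp add: sym_group_carrier)
  {
    assume conn: "connected_gluing N (ms, f)"
    show "transitive_pair ?A (face_perm ms) f"
      unfolding transitive_pair_def
    proof (intro allI impI)
      fix S assume S: "S \<subseteq> ?A" "S \<noteq> {}" "face_perm ms ` S \<subseteq> S" "f ` S \<subseteq> S"
      have inv: "p ` S \<subseteq> S" if "p \<in> ?G" for p
        using that
      proof (induction rule: generate.induct)
        case one
        then show ?case by (simp add: sym_group_one)
      next
        case (incl h)
        then show ?case using S by auto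
      next
        case (inv h)
        then have h: "h permutes ?A" "h ` S \<subseteq> S" using assms S by auto
        have "h ` S = S"
          using endo_inj_surj[of S h] finite_subset[OF S(1)] h(2) permutes_inj_on[OF h(1)] by simp
        then have "inv' h ` S = S" using h(1) by (metis image_inv_f_f permutes_inj)
        then show ?case
          using h(1) by (simp add: sym_group_inv_equality sym_group_carrier)
      next
        case (eng h1 h2)
        then show ?case by (auto simp: sym_group_mult)
      qed
      obtain x where x: "x \<in> S" using S(2) by auto
      have "y \<in> S" if "y \<in> ?A" for y
      proof -
        have "\<exists>p\<in>?G. p x = y"
          using conn that x S(1) unfolding connected_gluing_def case_prod_conv by blast
        then show ?thesis using inv x by blast
      qed
      then show "S = ?A" using S(1) by auto
    qed
  next
    assume trans: "transitive_pair ?A (face_perm ms) f"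
    have "\<exists>p\<in>?G. p x = y" if "x \<in> ?A" "y \<in> ?A" for x y
    proof -
      define S where "S = (\<lambda>p. p x) ` ?G"
      have "id \<in> ?G" using generate.one[of "sym_group (2 * N)" ?H] by (simp add: sym_group_one)
      then have x: "x \<in> S" unfolding S_def by (rule image_eqI[rotated]) simp
      have "p permutes ?A" if "p \<in> ?G" for p
        using group.generate_in_carrier[OF sym_group_is_group H that] by (simp add: sym_group_carrier)
      then have S: "S \<subseteq> ?A" unfolding S_def using \<open>x \<in> ?A\<close> permutes_in_image by fastforce
      have inv: "h ` S \<subseteq> S" if "h \<in> ?H" for h
      proof
        fix z assume "z \<in> h ` S"
        then obtain p where p: "p \<in> ?G" "z = h (p x)" unfolding S_def by auto
        have "h \<circ> p \<in> ?G"
          using generate.eng[OF generate.incl[OF that] p(1)] by (simp add: sym_group_mult)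
        then show "z \<in> S" unfolding S_def by (rule image_eqI[rotated]) (simp add: p(2))
      qed
      have "S \<noteq> {}" using x by auto
      then have "S = ?A"
        using trans[unfolded transitive_pair_def, rule_format, OF S] inv by simp
      then have "y \<in> S" using that(2) by simp
      then show ?thesis unfolding S_def by blast
    qed
    then show "connected_gluing N (ms, f)" unfolding connected_gluing_def case_prod_conv by blast
  }
qed

lemma num_cycles_eq_ncyc: "num_cycles n p = ncyc {1..n} p"
  by (simp add: num_cycles_def ncyc_def)

lemma matchings_iff_gluing_involution:
  "f \<in> matchings A \<longleftrightarrow> f permutes A \<and> (\<forall>x\<in>A. f x \<noteq> x \<and> f (f x) = x)"
proof -
  have "f (f x) = x" if "f permutes A" "x \<notin> A" for x using that by (simp add: permutes_not_in)
  then show ?thesis unfolding matchings_def involution_on_def by auto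
qed

section \<open>The counts as functions of the face lengths\<close>

definition one_count :: "nat \<Rightarrow> nat" where
  "one_count n = count1 [1..<Suc n]"

definition two_count :: "nat \<Rightarrow> nat \<Rightarrow> nat" where
  "two_count m k = count2 [1..<Suc m] [Suc m..<Suc (m + k)]"

lemma count1_eq_one_count: "distinct (xs :: nat list) \<Longrightarrow> count1 xs = one_count (length xs)"
  unfolding one_count_def by (rule count1_length) (auto simp del: upt_Suc)

lemma count2_eq_two_count: "distinct (xs @ ys :: nat list) \<Longrightarrow> count2 xs ys = two_count (length xs) (length ys)"
  unfolding two_count_def by (rule count2_length) (auto simp del: upt_Suc)

lemma one_count_0: "one_count 0 = 1"
  by (simp add: one_count_def count1_def planar1_def matchings_empty)

text \<open>The equation \<open>2 * c = n + 2\<close> required by \<open>planar1\<close> has no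
  solution for odd \<open>n\<close>.\<close>

lemma one_count_odd:
  assumes "odd n"
  shows "one_count n = 0"
proof -
  have "n \<noteq> 0" using assms by (rule odd_pos[THEN gr_implies_not0])
  moreover have "\<not> 2 * c = n + 2" for c :: nat using assms by presburger
  ultimately show ?thesis by (auto simp: one_count_def count1_def planar1_def)
qed

text \<open>An empty first face is invariant and hence not connected to the second. This zero and
  the next one allow sums over lengths to include their end points.\<close>

lemma two_count_0_left: "two_count 0 k = 0"
  by (simp add: two_count_def count2_def planar2_def)

lemma two_count_0_right: "two_count m 0 = 0"
proof -
  have "f ` set xs \<subseteq> set xs" if "f \<in> matchings (set xs)" for f :: "nat \<Rightarrow> nat" and xs
    using matchingsD(4)[OF that] by auto
  then have "{f \<in> matchings (set xs \<union> set []). planar2 xs [] f} = {}" for xs :: "nat list"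
    by (auto simp: planar2_def)
  then have "count2 xs [] = 0" for xs :: "nat list" by (simp only: count2_def card.empty)
  then show ?thesis by (simp add: two_count_def del: upt_Suc)
qed

text \<open>Merging leaves \<open>m + k - 1\<close> of the \<open>m + k + 1\<close> labels,
  whichever of the \<open>k\<close> partners is chosen. For \<open>k = 0\<close> the factor
  \<open>k\<close> annihilates the term with its possibly truncated subtraction.\<close>

lemma two_count_Suc:
  "two_count (Suc m) k = (\<Sum>i<m. one_count i * two_count (m - Suc i) k + one_count (m - Suc i) * two_count i k) + k * one_count (m + k - 1)"
proof -
  let ?xs = "[2..<Suc (Suc m)]" and ?ys = "[Suc (Suc m)..<Suc (Suc m + k)]"
  have dist: "distinct (1 # ?xs @ ?ys)" by auto
  have "two_count (Suc m) k = count2 (1 # ?xs) ?ys"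
    using dist by (subst count2_eq_two_count) (simp_all del: upt_Suc)
  also have "\<dots> = (\<Sum>i<length ?xs. count1 (take i ?xs) * count2 (drop (Suc i) ?xs) ?ys
      + count1 (drop (Suc i) ?xs) * count2 (take i ?xs) ?ys)
    + (\<Sum>j<length ?ys. count1 (drop (Suc j) ?ys @ take j ?ys @ ?xs))"
    using dist by (rule count2_rec)
  also have "(\<Sum>i<length ?xs. count1 (take i ?xs) * count2 (drop (Suc i) ?xs) ?ys
      + count1 (drop (Suc i) ?xs) * count2 (take i ?xs) ?ys)
    = (\<Sum>i<m. one_count i * two_count (m - Suc i) k + one_count (m - Suc i) * two_count i k)"
  proof (rule sum.cong)
    fix i assume "i \<in> {..<m}"
    then show "count1 (take i ?xs) * count2 (drop (Suc i) ?xs) ?ys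
      + count1 (drop (Suc i) ?xs) * count2 (take i ?xs) ?ys
      = one_count i * two_count (m - Suc i) k + one_count (m - Suc i) * two_count i k"
      by (simp add: count1_eq_one_count count2_eq_two_count take_upt del: upt_Suc)
  qed (simp del: upt_Suc)
  also have "(\<Sum>j<length ?ys. count1 (drop (Suc j) ?ys @ take j ?ys @ ?xs)) = (\<Sum>j<k. one_count (m + k - 1))"
  proof (rule sum.cong)
    fix j assume j: "j \<in> {..<k}"
    then have "distinct (drop (Suc j) ?ys @ take j ?ys @ ?xs)"
      by (auto simp: take_upt simp del: upt_Suc)
    moreover have "length (drop (Suc j) ?ys @ take j ?ys @ ?xs) = m + k - 1"
      using j by auto
    ultimately show "count1 (drop (Suc j) ?ys @ take j ?ys @ ?xs) = one_count (m + k - 1)"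
      by (metis count1_eq_one_count)
  qed (simp del: upt_Suc)
  finally show ?thesis by simp
qed

text \<open>The composition can only be \<open>[2 * N]\<close>, and one face is always connected.
  Genus 0 asks for \<open>N + 1\<close> cycles; doubled, this is the equation in
  \<open>planar1\<close>.\<close>

lemma polygon_gluings_eq:
  assumes "N \<ge> 1"
  shows "gluings 0 N 1 = Pair [2 * N] ` {f \<in> matchings {1..2 * N}. planar1 [1..<Suc (2 * N)] f}"
proof -
  let ?A = "{1..2 * N}" and ?xs = "[1..<Suc (2 * N)]"
  have set: "set ?xs = ?A" by auto
  have dist: "distinct ?xs" and len: "length ?xs = 2 * N" by simp_all
  have ne: "?xs \<noteq> []" using assms by simp
  have face: "face_perm [2 * N] = cycle_of_list ?xs" by (simp add: face_perm_def face_offset_def)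
  have perm: "cycle_of_list ?xs permutes ?A" using cycle_permutes[of ?xs] unfolding set .
  have datum: "gluing_datum N 1 (ms, f) \<longleftrightarrow> ms = [2 * N] \<and> f \<in> matchings ?A" for ms f
    using assms unfolding gluing_datum_def matchings_iff_gluing_involution
    by (auto simp: length_Suc_conv)
  have conn: "connected_gluing N ([2 * N], f)" if "f \<in> matchings ?A" for f
  proof -
    have "transitive_pair (set ?xs) (faces_perm [?xs]) f" using dist by (rule transitive_one_face)
    then show ?thesis
      using connected_gluing_iff_transitive_pair[of f N "[2 * N]"] matchingsD(1)[OF that] perm
      unfolding face set by (simp add: faces_perm_simps)
  qed
  have genus: "has_genus 0 N 1 ([2 * N], f) \<longleftrightarrow> planar1 ?xs f" if "f \<in> matchings ?A" for f
    unfolding has_genus_def planar1_def case_prod_conv num_cycles_eq_ncyc face set len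
      ncyc_comp_commute[OF matchingsD(1)[OF that]]
    using ne by auto
  show ?thesis
  proof (intro subset_antisym subsetI)
    fix d assume d: "d \<in> gluings 0 N 1"
    obtain ms f where "d = (ms, f)" by (cases d)
    then show "d \<in> Pair [2 * N] ` {f \<in> matchings ?A. planar1 ?xs f}"
      using d datum[of ms f] genus[of f] unfolding gluings_def by auto
  next
    fix d assume "d \<in> Pair [2 * N] ` {f \<in> matchings ?A. planar1 ?xs f}"
    then show "d \<in> gluings 0 N 1" using datum conn genus unfolding gluings_def by blast
  qed
qed

lemma polygon_gluing_count_eq_one_count: "\<epsilon>\<^sub>P 0 N = one_count (2 * N)"
proof (cases "N = 0")
  case False
  then have "card (gluings 0 N 1) = card {f \<in> matchings {1..2 * N}. planar1 [1..<Suc (2 * N)] f}"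
    by (subst polygon_gluings_eq) (auto simp: card_image inj_on_def simp del: upt_Suc)
  moreover have "{1..2 * N} = set [1..<Suc (2 * N)]" by auto
  ultimately show ?thesis using False by (simp only: gluing_count_def one_count_def count1_def if_False)
qed (simp add: gluing_count_def one_count_0)

text \<open>A composition into two parts is given by its first part \<open>m\<close>. Genus 0 asks
  for \<open>N\<close> cycles, and \<open>2 * N\<close> is the sum of the two face lengths in
  \<open>planar2\<close>.\<close>

lemma two_face_gluings_eq:
  assumes "N \<ge> 1"
  shows "gluings 0 N 2 = (\<Union>m\<in>{1..<2 * N}. Pair [m, 2 * N - m] `
    {f \<in> matchings {1..2 * N}. planar2 [1..<Suc m] [Suc m..<Suc (2 * N)] f})"
proof -
  let ?A = "{1..2 * N}" and ?xs = "\<lambda>m. [1..<Suc m]" and ?ys = "\<lambda>m. [Suc m..<Suc (2 * N)]"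
  have set: "set (?xs m) \<union> set (?ys m) = ?A" if "m \<in> {1..<2 * N}" for m
    using that by auto
  have dist: "distinct (?xs m @ ?ys m)" for m by auto
  have face: "face_perm [m, 2 * N - m] = cycle_of_list (?xs m) \<circ> cycle_of_list (?ys m)"
    if "m \<in> {1..<2 * N}" for m
    using that by (simp add: face_perm_def face_offset_def del: upt_Suc) (simp add: upt_rec)
  have perm: "cycle_of_list (?xs m) \<circ> cycle_of_list (?ys m) permutes ?A" if "m \<in> {1..<2 * N}" for m
    unfolding set[OF that, symmetric] by (intro permutes_compose cycle_of_list_permutes) auto
  have datum: "gluing_datum N 2 (ms, f)
      \<longleftrightarrow> (\<exists>m\<in>{1..<2 * N}. ms = [m, 2 * N - m]) \<and> f \<in> matchings ?A" for ms f
  proof -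
    have "length ms = 2 \<and> (\<forall>m\<in>set ms. 0 < m) \<and> sum_list ms = 2 * N
        \<longleftrightarrow> (\<exists>m\<in>{1..<2 * N}. ms = [m, 2 * N - m])"
      by (auto simp: length_Suc_conv numeral_2_eq_2)
    then show ?thesis unfolding gluing_datum_def matchings_iff_gluing_involution by auto
  qed
  have conn: "connected_gluing N ([m, 2 * N - m], f) \<longleftrightarrow> \<not> f ` set (?xs m) \<subseteq> set (?xs m)"
    if m: "m \<in> {1..<2 * N}" and f: "f \<in> matchings ?A" for m f
  proof -
    have "connected_gluing N ([m, 2 * N - m], f)
        \<longleftrightarrow> transitive_pair ?A (cycle_of_list (?xs m) \<circ> cycle_of_list (?ys m)) f"
      by (rule connected_gluing_iff_transitive_pair[OF matchingsD(1)[OF f], of "[m, 2 * N - m]",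
            unfolded face[OF m], OF perm[OF m]])
    also have "\<dots> \<longleftrightarrow> \<not> f ` set (?xs m) \<subseteq> set (?xs m)"
    proof
      assume "\<not> f ` set (?xs m) \<subseteq> set (?xs m)"
      then show "transitive_pair ?A (cycle_of_list (?xs m) \<circ> cycle_of_list (?ys m)) f"
        using transitive_two_faces[OF dist, of f m] f unfolding set[OF m]
        by (simp add: faces_perm_simps del: upt_Suc)
    next
      \<comment> \<open>The first face is a proper nonempty set invariant under the face
        permutation, so a transitive pair requires \<open>f\<close> to leave it.\<close>
      assume trans: "transitive_pair ?A (cycle_of_list (?xs m) \<circ> cycle_of_list (?ys m)) f"
      have "cycle_of_list (?ys m) ` set (?xs m) = set (?xs m)"
        using id_outside_supp[of _ "?ys m"] by (force simp del: upt_Suc)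
      then have "(cycle_of_list (?xs m) \<circ> cycle_of_list (?ys m)) ` set (?xs m) \<subseteq> set (?xs m)"
        by (simp only: image_comp[symmetric] permutes_image[OF cycle_permutes])
      moreover have "set (?xs m) \<subseteq> ?A" "set (?xs m) \<noteq> {}" "set (?xs m) \<noteq> ?A"
        using m by (auto simp del: upt_Suc)
      ultimately show "\<not> f ` set (?xs m) \<subseteq> set (?xs m)"
        using trans unfolding transitive_pair_def by blast
    qed
    finally show ?thesis .
  qed
  have genus: "has_genus 0 N 2 ([m, 2 * N - m], f) \<longleftrightarrow>
      2 * ncyc ?A (f \<circ> cycle_of_list (?xs m) \<circ> cycle_of_list (?ys m)) = length (?xs m) + length (?ys m)"
    if m: "m \<in> {1..<2 * N}" and f: "f \<in> matchings ?A" for m f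
  proof -
    have "length (?xs m) + length (?ys m) = 2 * N" using m by simp
    then show ?thesis
      unfolding has_genus_def case_prod_conv num_cycles_eq_ncyc face[OF m]
        ncyc_comp_commute[OF matchingsD(1)[OF f]] by (simp add: comp_assoc del: upt_Suc)
  qed
  have planar: "connected_gluing N ([m, 2 * N - m], f) \<and> has_genus 0 N 2 ([m, 2 * N - m], f)
      \<longleftrightarrow> planar2 (?xs m) (?ys m) f" if "m \<in> {1..<2 * N}" "f \<in> matchings ?A" for m f
    using conn[OF that] genus[OF that] unfolding planar2_def set[OF that(1)] by blast
  show ?thesis
  proof (intro subset_antisym subsetI)
    fix d assume d: "d \<in> gluings 0 N 2"
    obtain ms f where msf: "d = (ms, f)" by (cases d)
    then obtain m where "m \<in> {1..<2 * N}" "ms = [m, 2 * N - m]" "f \<in> matchings ?A"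
      using d datum unfolding gluings_def by blast
    moreover from this have "planar2 (?xs m) (?ys m) f"
      using planar d msf unfolding gluings_def by blast
    ultimately show "d \<in> (\<Union>m\<in>{1..<2 * N}. Pair [m, 2 * N - m] `
        {f \<in> matchings ?A. planar2 (?xs m) (?ys m) f})" using msf by blast
  next
    fix d assume "d \<in> (\<Union>m\<in>{1..<2 * N}. Pair [m, 2 * N - m] `
        {f \<in> matchings ?A. planar2 (?xs m) (?ys m) f})"
    then show "d \<in> gluings 0 N 2" using datum planar unfolding gluings_def by blast
  qed
qed

text \<open>The end points \<open>m = 0\<close> and \<open>m = 2 * N\<close> do not come from
  compositions but contribute 0. Including them makes the sum a full antidiagonal, and the formula
  also holds for \<open>N = 0\<close>.\<close>

lemma two_face_gluing_count_eq_two_count: "\<epsilon> 0 N 2 = (\<Sum>m\<le>2 * N. two_count m (2 * N - m))"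
proof (cases "N = 0")
  case False
  let ?P = "\<lambda>m. {f \<in> matchings {1..2 * N}. planar2 [1..<Suc m] [Suc m..<Suc (2 * N)] f}"
  have P: "card (?P m) = two_count m (2 * N - m)" if "m \<in> {1..<2 * N}" for m
  proof -
    have "m + (2 * N - m) = 2 * N" using that by simp
    moreover have "{1..2 * N} = set [1..<Suc m] \<union> set [Suc m..<Suc (2 * N)]" using that by auto
    ultimately show ?thesis by (simp only: two_count_def count2_def)
  qed
  have "\<epsilon> 0 N 2 = card (\<Union>m\<in>{1..<2 * N}. Pair [m, 2 * N - m] ` ?P m)"
    using False by (simp add: gluing_count_def two_face_gluings_eq del: upt_Suc)
  also have "\<dots> = (\<Sum>m\<in>{1..<2 * N}. card (Pair [m, 2 * N - m] ` ?P m))"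
    by (rule card_UN_disjoint) (auto simp: finite_matchings simp del: upt_Suc)
  also have "\<dots> = (\<Sum>m\<in>{1..<2 * N}. two_count m (2 * N - m))"
  proof (rule sum.cong[OF refl])
    fix m assume m: "m \<in> {1..<2 * N}"
    have "card (Pair [m, 2 * N - m] ` ?P m) = card (?P m)"
      by (rule card_image) (simp add: inj_on_def)
    also have "\<dots> = two_count m (2 * N - m)" using m by (rule P)
    finally show "card (Pair [m, 2 * N - m] ` ?P m) = two_count m (2 * N - m)" .
  qed
  also have "\<dots> = (\<Sum>m\<le>2 * N. two_count m (2 * N - m))"
  proof (rule sum.mono_neutral_left)
    show "\<forall>m\<in>{..2 * N} - {1..<2 * N}. two_count m (2 * N - m) = 0"
    proof
      fix m assume "m \<in> {..2 * N} - {1..<2 * N}"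
      then have "m = 0 \<or> 2 * N - m = 0" by auto
      then show "two_count m (2 * N - m) = 0" by (auto simp: two_count_0_left two_count_0_right)
    qed
  qed auto
  finally show ?thesis .
qed (simp add: gluing_count_def two_count_0_left)

subsection \<open>The convolution\<close>

text \<open>With \<open>p = n - i\<close> the second length \<open>r - n\<close> becomes
  \<open>r - i - p\<close>. The inner sum then runs over all pairs of lengths with total
  \<open>r - i\<close>, which recovers the two-face totals.\<close>

lemma sum_triangle_convolution:
  fixes g :: "nat \<Rightarrow> nat" and h :: "nat \<Rightarrow> nat \<Rightarrow> nat"
  shows "(\<Sum>n\<le>r. \<Sum>i\<le>n. g i * h (n - i) (r - n)) = (\<Sum>i\<le>r. g i * (\<Sum>p\<le>r - i. h p (r - i - p)))"
proof -
  have "(\<Sum>n\<le>r. \<Sum>i\<le>n. g i * h (n - i) (r - n)) = (\<Sum>n\<le>r. \<Sum>i\<le>n. g i * h (n - i) (r - i - (n - i)))"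
    by (intro sum.cong) auto
  also have "\<dots> = (\<Sum>(i, p)\<in>{(i, p). i + p \<le> r}. g i * h p (r - i - p))"
    by (rule sum.triangle_reindex_eq[symmetric])
  also have "{(i, p). i + p \<le> r} = Sigma {..r} (\<lambda>i. {..r - i})" by auto
  also have "(\<Sum>(i, p)\<in>\<dots>. g i * h p (r - i - p)) = (\<Sum>i\<le>r. \<Sum>p\<le>r - i. g i * h p (r - i - p))"
    by (rule sum.Sigma[symmetric]) auto
  finally show ?thesis by (simp add: sum_distrib_left)
qed

lemma sum_even:
  fixes h :: "nat \<Rightarrow> nat"
  assumes "\<And>i. odd i \<Longrightarrow> h i = 0"
  shows "(\<Sum>i\<le>2 * M. h i) = (\<Sum>k\<le>M. h (2 * k))"
  using assms by (induction M) auto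

lemma sum_two_count_rec:
  assumes "N \<ge> 1"
  shows "(\<Sum>m\<le>2 * N. two_count m (2 * N - m)) =
    2 * (\<Sum>i\<le>2 * (N - 1). one_count i * (\<Sum>p\<le>2 * (N - 1) - i. two_count p (2 * (N - 1) - i - p)))
    + N * (2 * N - 1) * one_count (2 * (N - 1))"
proof -
  define r where "r = 2 * (N - 1)"
  have r: "2 * N = Suc (Suc r)" using assms by (simp add: r_def)
  have sym: "(\<Sum>i<m. one_count i * two_count (m - Suc i) k + one_count (m - Suc i) * two_count i k)
      = 2 * (\<Sum>i<m. one_count i * two_count (m - Suc i) k)" for m k
  proof -
    \<comment> \<open>The reflection of \<open>i\<close> to \<open>m - Suc i\<close> exchanges the
      two parts of the split polygon.\<close>
    have "(\<Sum>i<m. one_count (m - Suc i) * two_count i k) = (\<Sum>i<m. one_count (m - Suc i) * two_count (m - Suc (m - Suc i)) k)"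
      by (intro sum.cong) auto
    also have "\<dots> = (\<Sum>i<m. one_count i * two_count (m - Suc i) k)"
      by (rule sum.nat_diff_reindex)
    finally show ?thesis by (simp add: sum.distrib)
  qed
  have "(\<Sum>m\<le>2 * N. two_count m (2 * N - m)) = (\<Sum>m\<le>Suc r. two_count (Suc m) (Suc r - m))"
    unfolding r by (subst sum.atMost_Suc_shift) (simp add: two_count_0_left)
  also have "\<dots> = (\<Sum>m\<le>Suc r. 2 * (\<Sum>i<m. one_count i * two_count (m - Suc i) (Suc r - m)) + (Suc r - m) * one_count r)"
    \<comment> \<open>With \<open>k = Suc r - m\<close> the merged polygon has length
      \<open>m + k - 1 = r\<close>, whatever \<open>m\<close> is, so its count factors out of the
      sum.\<close>
    unfolding two_count_Suc sym by (intro sum.cong) auto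
  also have "\<dots> = 2 * (\<Sum>m\<le>Suc r. \<Sum>i<m. one_count i * two_count (m - Suc i) (Suc r - m))
      + (\<Sum>m\<le>Suc r. Suc r - m) * one_count r"
    by (simp only: sum.distrib sum_distrib_left sum_distrib_right)
  also have "(\<Sum>m\<le>Suc r. \<Sum>i<m. one_count i * two_count (m - Suc i) (Suc r - m))
      = (\<Sum>n\<le>r. \<Sum>i\<le>n. one_count i * two_count (n - i) (r - n))"
    by (subst sum.atMost_Suc_shift) (simp add: lessThan_Suc_atMost)
  also have "\<dots> = (\<Sum>i\<le>r. one_count i * (\<Sum>p\<le>r - i. two_count p (r - i - p)))"
    by (rule sum_triangle_convolution)
  also have "(\<Sum>m\<le>Suc r. Suc r - m) = N * (2 * N - 1)"
  proof -
    \<comment> \<open>Reversal turns the lengths of the second polygon into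
      \<open>0, ..., 2 * N - 1\<close>, whose sum is \<open>N * (2 * N - 1)\<close>.\<close>
    have "(\<Sum>m\<le>Suc r. Suc r - m) = (\<Sum>m\<le>Suc r. m)"
      using sum.atLeastAtMost_rev[of "\<lambda>m. m" 0 "Suc r"] by (simp only: atMost_atLeast0 add_0_right)
    also have "\<dots> = Suc r * Suc (Suc r) div 2"
      unfolding atMost_atLeast0 by (rule gauss_sum_nat)
    also have "\<dots> = Suc r * N" unfolding r[symmetric] by simp
    finally show ?thesis using r by simp
  qed
  finally show ?thesis by (simp only: r_def)
qed

theorem theorem1:
  fixes N :: nat
  assumes "N \<ge> 2"
  shows "\<epsilon> 0 N 2 =
    2 * (\<Sum>i = 0..N - 2. \<epsilon>\<^sub>P 0 i * \<epsilon> 0 (N - i - 1) 2) + N * (2 * N - 1) * \<epsilon>\<^sub>P 0 (N - 1)"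
proof -
  let ?T = "\<lambda>s. \<Sum>p\<le>s. two_count p (s - p)"
  \<comment> \<open>Only parts of even length \<open>2 * k\<close> have planar gluings to
    themselves; \<open>k\<close> is their number of edges after gluing.\<close>
  have "(\<Sum>i\<le>2 * (N - 1). one_count i * ?T (2 * (N - 1) - i))
      = (\<Sum>k\<le>N - 1. one_count (2 * k) * ?T (2 * (N - 1) - 2 * k))"
    by (rule sum_even) (simp add: one_count_odd)
  also have "\<dots> = (\<Sum>k\<le>N - 1. \<epsilon>\<^sub>P 0 k * \<epsilon> 0 (N - k - 1) 2)"
  proof (rule sum.cong[OF refl])
    fix k
    have "2 * (N - 1) - 2 * k = 2 * (N - k - 1)" by simp
    then show "one_count (2 * k) * ?T (2 * (N - 1) - 2 * k) = \<epsilon>\<^sub>P 0 k * \<epsilon> 0 (N - k - 1) 2"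
      by (simp only: polygon_gluing_count_eq_one_count two_face_gluing_count_eq_two_count)
  qed
  \<comment> \<open>For \<open>k = N - 1\<close> the second factor is
    \<open>\<epsilon> 0 0 2\<close>, which is 0 by convention, so the sum may end at
    \<open>N - 2\<close>.\<close>
  also have "{..N - 1} = insert (N - 1) {0..N - 2}" using assms by auto
  also have "(\<Sum>k\<in>\<dots>. \<epsilon>\<^sub>P 0 k * \<epsilon> 0 (N - k - 1) 2) = (\<Sum>k = 0..N - 2. \<epsilon>\<^sub>P 0 k * \<epsilon> 0 (N - k - 1) 2)"
    using assms by (subst sum.insert) (auto simp: gluing_count_def)
  finally show ?thesis
    using sum_two_count_rec[of N] assms by (simp only: two_face_gluing_count_eq_two_count[of N] polygon_gluing_count_eq_one_count[of "N - 1"])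
qed

end
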